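(* Assume $-F'(\bar u)\in\partial G_2(\bar u)$. If $\bar u\ne0$, then $$G_2''(\bar u,-F'(\bar u);v)=\frac{\mu}{j_2(\bar u)}\Big(\int_0^Tj_\Omega'(\bar u(t);v(t))^2\,\mathrm dt-j_2'(\bar u;v)^2\Big)\qquad\forall v\in C_{\bar u},$$ and $G_2$ is strongly twice epi-differentiable at $\bar u$ for $-F'(\bar u)$. If $\bar u=0$, then $$G_2''(\bar u,-F'(\bar u);v)\ge0\quad\forall v\in C_{\bar u}\qquad\text{and}\qquad G_2''(\bar u,-F'(\bar u);v)=\infty\quad\forall v\in L^2(\Omega_T)\setminus C_{\bar u}.$$
   Context: Setting: $\Omega\subset\mathbb R^d$ is non-empty, open and bounded, $T>0$, $\Omega_T:=\Omega\times(0,T)$; $\alpha<\beta$ are real constants, $\mu>0$; $U_{\mathrm{ad}}:=\{u\in L^2(\Omega_T):\alpha\le u\le\beta\text{ a.e.}\}$, with indicator function $\delta_{U_{\mathrm{ad}}}\colon L^2(\Omega_T)\to\{0,\infty\}$; $\bar u\in U_{\mathrm{ad}}$ is fixed. $j_2(u):=\big[\int_0^T\|u(\cdot,t)\|_{L^1(\Omega)}^2\,\mathrm dt\big]^{1/2}$ and $G_2:=\delta_{U_{\mathrm{ad}}}+\mu j_2$, a convex function on $L^2(\Omega_T)$ with convex subdifferential $\partial G_2$. Further, $j_\Omega(u):=\|u\|_{L^1(\Omega)}$ for $u\in L^2(\Omega)$, with directional derivative $j_\Omega'(u;v)=\int_{\{u>0\}}v\,\mathrm dx-\int_{\{u<0\}}v\,\mathrm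 dx+\int_{\{u=0\}}|v|\,\mathrm dx$; and $j_2'(\bar u;v)$ is the directional derivative of $j_2$. $F\colon U_{\mathrm{ad}}\to\mathbb R$ is such that there are $F'(\bar u)\in L^2(\Omega_T)$ and a bounded bilinear form $F''(\bar u)$ on $L^2(\Omega_T)$ with $\lim_{k\to\infty}t_k^{-2}\big(F(\bar u+t_kv_k)-F(\bar u)-t_kF'(\bar u)v_k-\frac12t_k^2F''(\bar u)v_k^2\big)=0$ for all $t_k\searrow0$ ($t_k>0$), $v_k\rightharpoonup v$ in $L^2(\Omega_T)$ with $\bar u+t_kv_k\in U_{\mathrm{ad}}$. Here $F'(\bar u)v=\int_{\Omega_T}F'(\bar u)v$. Tangent cone: $\mathcal T_{U_{\mathrm{ad}}}(\bar u)=\{v\in L^2(\Omega_T): v\ge0\text{ a.e. where }\bar u=\alpha,\ v\le0\text{ a.e. where }\bar u=\beta\}$. Critical cone: $C_{\bar u}:=\{v\in\mathcal T_{U_{\mathrm{ad}}}(\bar u):F'(\bar u)v+\mu j_2'(\bar u;v)=0\}$. Weak second subderivative: for $w,v\in L^2(\Omega_T)$, $$G_2''(\bar u,w;v):=\inf\Big\{\liminf_{k\to\infty}\frac{G_2(\bar u+t_kv_k)-G_2(\bar u)-t_k\langle w,v_k\rangle}{t_k^2/2}: t_k\searrow0,\ v_k\rightharpoonup v\text{ in }L^2(\Omega_T)\Big\}.$$ $G_2$ is strongly twice epi-differentiable at $\bar u$ for $w$ if for every $v\in L^2(\Omega_T)$ and every $(t_k)\subset(0,\infty)$ with $t_k\searrow0$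 there is $v_k\to v$ (strongly in $L^2(\Omega_T)$) such that the quotients $\frac{G_2(\bar u+t_kv_k)-G_2(\bar u)-t_k\langle w,v_k\rangle}{t_k^2/2}$ converge to $G_2''(\bar u,w;v)$. *)

theory Defs
  imports "HOL-Analysis.Analysis"
begin

text \<open>
  Elements of \<open>L\<^sup>2(M)\<close> are represented by square-integrable functions, not by equivalence classes;
  equality of elements is equality almost everywhere. All domains carry the restriction of
  \<^const>\<open>lborel\<close>, so representatives are Borel measurable on the domain (every class of
  Lebesgue measurable functions has such a representative) and their values off the domain are
  irrelevant.
\<close>

definition L2 :: "'x measure \<Rightarrow> ('x \<Rightarrow> real) set" where
  "L2 M = {f \<in> borel_measurable M. integrable M (\<lambda>x. (f x)\<^sup>2)}"

definition L2_inner :: "'x measure \<Rightarrow> ('x \<Rightarrow> real) \<Rightarrow> ('x \<Rightarrow> real) \<Rightarrow> real" where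
  "L2_inner M f g = (\<integral>x. f x * g x \<partial>M)"

definition L2_norm :: "'x measure \<Rightarrow> ('x \<Rightarrow> real) \<Rightarrow> real" where
  "L2_norm M f = sqrt (\<integral>x. (f x)\<^sup>2 \<partial>M)"

definition L1_norm :: "'x measure \<Rightarrow> ('x \<Rightarrow> real) \<Rightarrow> real" where
  "L1_norm M f = (\<integral>x. \<bar>f x\<bar> \<partial>M)"

definition L2_strong_conv :: "'x measure \<Rightarrow> (nat \<Rightarrow> 'x \<Rightarrow> real) \<Rightarrow> ('x \<Rightarrow> real) \<Rightarrow> bool" where
  "L2_strong_conv M vs v \<longleftrightarrow> (\<forall>k. vs k \<in> L2 M) \<and> v \<in> L2 M \<and>
     (\<lambda>k. L2_norm M (\<lambda>x. vs k x - v x)) \<longlonglongrightarrow> 0"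

definition L2_weak_conv :: "'x measure \<Rightarrow> (nat \<Rightarrow> 'x \<Rightarrow> real) \<Rightarrow> ('x \<Rightarrow> real) \<Rightarrow> bool" where
  "L2_weak_conv M vs v \<longleftrightarrow> (\<forall>k. vs k \<in> L2 M) \<and> v \<in> L2 M \<and>
     (\<forall>g\<in>L2 M. (\<lambda>k. L2_inner M (vs k) g) \<longlonglongrightarrow> L2_inner M v g)"

definition L2_bounded_bilinear ::
  "'x measure \<Rightarrow> (('x \<Rightarrow> real) \<Rightarrow> ('x \<Rightarrow> real) \<Rightarrow> real) \<Rightarrow> bool" where
  "L2_bounded_bilinear M B \<longleftrightarrow>
     (\<forall>f\<in>L2 M. \<forall>g\<in>L2 M. \<forall>h\<in>L2 M. \<forall>a b.
        B (\<lambda>x. a * f x + b * g x) h = a * B f h + b * B g h \<and>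
        B h (\<lambda>x. a * f x + b * g x) = a * B h f + b * B h g) \<and>
     (\<exists>K. \<forall>f\<in>L2 M. \<forall>g\<in>L2 M. \<bar>B f g\<bar> \<le> K * L2_norm M f * L2_norm M g)"

text \<open>\<open>t\<^sub>k \<searrow> 0\<close>: positive and convergent to 0, not necessarily monotone.\<close>

definition pos_null_seq :: "(nat \<Rightarrow> real) \<Rightarrow> bool" where
  "pos_null_seq t \<longleftrightarrow> (\<forall>k. t k > 0) \<and> t \<longlonglongrightarrow> 0"

definition dir_deriv :: "(('x \<Rightarrow> real) \<Rightarrow> real) \<Rightarrow> ('x \<Rightarrow> real) \<Rightarrow> ('x \<Rightarrow> real) \<Rightarrow> real" where
  "dir_deriv j u v = Lim (at_right 0) (\<lambda>t. (j (\<lambda>x. u x + t * v x) - j u) / t)"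

definition subdifferential ::
  "'x measure \<Rightarrow> (('x \<Rightarrow> real) \<Rightarrow> ereal) \<Rightarrow> ('x \<Rightarrow> real) \<Rightarrow> ('x \<Rightarrow> real) set" where
  "subdifferential M G u =
     {w \<in> L2 M. \<forall>z\<in>L2 M. G z \<ge> G u + ereal (L2_inner M w (\<lambda>x. z x - u x))}"

definition second_quotient ::
  "'x measure \<Rightarrow> (('x \<Rightarrow> real) \<Rightarrow> ereal) \<Rightarrow> ('x \<Rightarrow> real) \<Rightarrow> ('x \<Rightarrow> real) \<Rightarrow> real \<Rightarrow> ('x \<Rightarrow> real) \<Rightarrow> ereal" where
  "second_quotient M G u w t v =
     (G (\<lambda>x. u x + t * v x) - G u - ereal (t * L2_inner M w v)) / ereal (t\<^sup>2 / 2)"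

definition weak_second_subderivative ::
  "'x measure \<Rightarrow> (('x \<Rightarrow> real) \<Rightarrow> ereal) \<Rightarrow> ('x \<Rightarrow> real) \<Rightarrow> ('x \<Rightarrow> real) \<Rightarrow> ('x \<Rightarrow> real) \<Rightarrow> ereal" where
  "weak_second_subderivative M G u w v =
     Inf {liminf (\<lambda>k. second_quotient M G u w (t k) (vs k)) | t vs.
            pos_null_seq t \<and> L2_weak_conv M vs v}"

definition strongly_twice_epi_differentiable ::
  "'x measure \<Rightarrow> (('x \<Rightarrow> real) \<Rightarrow> ereal) \<Rightarrow> ('x \<Rightarrow> real) \<Rightarrow> ('x \<Rightarrow> real) \<Rightarrow> bool" where
  "strongly_twice_epi_differentiable M G u w \<longleftrightarrow>
     (\<forall>v\<in>L2 M. \<forall>t. pos_null_seq t \<longrightarrow>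
        (\<exists>vs. L2_strong_conv M vs v \<and>
           (\<lambda>k. second_quotient M G u w (t k) (vs k))
             \<longlonglongrightarrow> weak_second_subderivative M G u w v))"

abbreviation space_measure :: "'a::euclidean_space set \<Rightarrow> 'a measure" where
  "space_measure \<Omega> \<equiv> restrict_space lborel \<Omega>"

abbreviation time_measure :: "real \<Rightarrow> real measure" where
  "time_measure T \<equiv> restrict_space lborel {0<..<T}"

abbreviation cyl_measure :: "'a::euclidean_space set \<Rightarrow> real \<Rightarrow> ('a \<times> real) measure" where
  "cyl_measure \<Omega> T \<equiv> restrict_space lborel (\<Omega> \<times> {0<..<T})"

definition U_ad :: "'a::euclidean_space set \<Rightarrow> real \<Rightarrow> real \<Rightarrow> real \<Rightarrow> ('a \<times> real \<Rightarrow> real) set" where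
  "U_ad \<Omega> T \<alpha> \<beta> =
     {u \<in> L2 (cyl_measure \<Omega> T). AE z in cyl_measure \<Omega> T. \<alpha> \<le> u z \<and> u z \<le> \<beta>}"

definition indicator_fun :: "'b set \<Rightarrow> 'b \<Rightarrow> ereal" where
  "indicator_fun C u = (if u \<in> C then 0 else \<infinity>)"

definition j_Omega :: "'a::euclidean_space set \<Rightarrow> ('a \<Rightarrow> real) \<Rightarrow> real" where
  "j_Omega \<Omega> u = L1_norm (space_measure \<Omega>) u"

definition j_2 :: "'a::euclidean_space set \<Rightarrow> real \<Rightarrow> ('a \<times> real \<Rightarrow> real) \<Rightarrow> real" where
  "j_2 \<Omega> T u =
     sqrt (\<integral>t. (L1_norm (space_measure \<Omega>) (\<lambda>x. u (x, t)))\<^sup>2 \<partial>time_measure T)"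

definition G_2 ::
  "'a::euclidean_space set \<Rightarrow> real \<Rightarrow> real \<Rightarrow> real \<Rightarrow> real \<Rightarrow> ('a \<times> real \<Rightarrow> real) \<Rightarrow> ereal" where
  "G_2 \<Omega> T \<alpha> \<beta> \<mu> u = indicator_fun (U_ad \<Omega> T \<alpha> \<beta>) u + ereal (\<mu> * j_2 \<Omega> T u)"

definition tangent_cone ::
  "'a::euclidean_space set \<Rightarrow> real \<Rightarrow> real \<Rightarrow> real \<Rightarrow> ('a \<times> real \<Rightarrow> real) \<Rightarrow> ('a \<times> real \<Rightarrow> real) set" where
  "tangent_cone \<Omega> T \<alpha> \<beta> u =
     {v \<in> L2 (cyl_measure \<Omega> T).
        AE z in cyl_measure \<Omega> T. (u z = \<alpha> \<longrightarrow> v z \<ge> 0) \<and> (u z = \<beta> \<longrightarrow> v z \<le> 0)}"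

definition critical_cone ::
  "'a::euclidean_space set \<Rightarrow> real \<Rightarrow> real \<Rightarrow> real \<Rightarrow> real \<Rightarrow> ('a \<times> real \<Rightarrow> real) \<Rightarrow>
     ('a \<times> real \<Rightarrow> real) \<Rightarrow> ('a \<times> real \<Rightarrow> real) set" where
  "critical_cone \<Omega> T \<alpha> \<beta> \<mu> F1 u =
     {v \<in> tangent_cone \<Omega> T \<alpha> \<beta> u.
        L2_inner (cyl_measure \<Omega> T) F1 v + \<mu> * dir_deriv (j_2 \<Omega> T) u v = 0}"

text \<open>The directional derivative of the \<open>L\<^sup>1\<close>-norm exists and has the usual integral formula.\<close>

lemma L1_norm_directionally_differentiable:
  fixes u v :: "'x \<Rightarrow> real"
  assumes u: "integrable M u" and v: "integrable M v"
  shows "((\<lambda>t. (L1_norm M (\<lambda>x. u x + t * v x) - L1_norm M u) / t) \<longlongrightarrow>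
      (\<integral>x. (if u x > 0 then v x else if u x < 0 then - v x else \<bar>v x\<bar>) \<partial>M)) (at_right 0)"
    (is "(?q \<longlongrightarrow> (\<integral>x. ?d x \<partial>M)) _")
  unfolding tendsto_at_iff_sequentially comp_def
proof (intro allI impI)
  fix X :: "nat \<Rightarrow> real"
  assume X: "\<forall>i. X i \<in> {0<..} - {0}" and X0: "X \<longlonglongrightarrow> 0"
  have Xpos: "X i > 0" for i using X by auto
  let ?s = "\<lambda>i x. (\<bar>u x + X i * v x\<bar> - \<bar>u x\<bar>) / X i"
  have um[measurable]: "u \<in> borel_measurable M" and vm[measurable]: "v \<in> borel_measurable M"
    using u v by auto
  have "(\<lambda>i. \<integral>x. ?s i x \<partial>M) \<longlonglongrightarrow> (\<integral>x. ?d x \<partial>M)"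
  proof (rule integral_dominated_convergence[where w = "\<lambda>x. \<bar>v x\<bar>"])
    show "?d \<in> borel_measurable M" by measurable
    show "?s i \<in> borel_measurable M" for i by measurable
    show "integrable M (\<lambda>x. \<bar>v x\<bar>)" using v by simp
    show "AE x in M. norm (?s i x) \<le> \<bar>v x\<bar>" for i
    proof (rule AE_I2)
      fix x
      have "\<bar>\<bar>u x + X i * v x\<bar> - \<bar>u x\<bar>\<bar> \<le> X i * \<bar>v x\<bar>"
        using abs_triangle_ineq3[of "u x + X i * v x" "u x"] Xpos[of i] by (simp add: abs_mult)
      then show "norm (?s i x) \<le> \<bar>v x\<bar>"
        using Xpos[of i] by (simp add: abs_divide pos_divide_le_eq mult.commute)
    qed
    show "AE x in M. (\<lambda>i. ?s i x) \<longlonglongrightarrow> ?d x"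
    proof (rule AE_I2)
      fix x
      have lim: "(\<lambda>i. u x + X i * v x) \<longlonglongrightarrow> u x"
        using tendsto_add[OF tendsto_const tendsto_mult_left_zero[OF X0, of "v x"], of "u x"] by simp
      have "\<forall>\<^sub>F i in sequentially. ?d x = ?s i x"
      proof -
        consider "u x > 0" | "u x < 0" | "u x = 0" by linarith
        then show ?thesis
        proof cases
          case 1
          from order_tendstoD(1)[OF lim 1] show ?thesis
            by eventually_elim (use 1 Xpos in \<open>simp add: less_imp_neq[OF Xpos, symmetric]\<close>)
        next
          case 2
          from order_tendstoD(2)[OF lim 2] show ?thesis
            by eventually_elim (use 2 Xpos in \<open>simp add: less_imp_neq[OF Xpos, symmetric]\<close>)
        next
          case 3
          then show ?thesis
            by (simp add: abs_mult abs_of_pos[OF Xpos] less_imp_neq[OF Xpos, symmetric])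
        qed
      qed
      then show "(\<lambda>i. ?s i x) \<longlonglongrightarrow> ?d x"
        by (rule tendsto_eventually[OF eventually_mono]) auto
    qed
  qed
  moreover have "(\<integral>x. ?s i x \<partial>M) = ?q (X i)" for i
    unfolding L1_norm_def using u v by simp
  ultimately show "(\<lambda>i. ?q (X i)) \<longlonglongrightarrow> (\<integral>x. ?d x \<partial>M)" by (simp only:)
qed

lemma dir_deriv_j_Omega:
  assumes u: "integrable (space_measure \<Omega>) u" and v: "integrable (space_measure \<Omega>) v"
  shows "dir_deriv (j_Omega \<Omega>) u v =
    (LINT x:{x. u x > 0}|space_measure \<Omega>. v x) - (LINT x:{x. u x < 0}|space_measure \<Omega>. v x)
      + (LINT x:{x. u x = 0}|space_measure \<Omega>. \<bar>v x\<bar>)"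
proof -
  let ?M = "space_measure \<Omega>"
  have um[measurable]: "u \<in> borel_measurable ?M" and vm[measurable]: "v \<in> borel_measurable ?M"
    using u v by auto
  have i1: "integrable ?M (\<lambda>x. indicator {x. u x > 0} x *\<^sub>R v x)"
    by (rule Bochner_Integration.integrable_bound[OF v]) (auto simp: indicator_def)
  have i2: "integrable ?M (\<lambda>x. indicator {x. u x < 0} x *\<^sub>R v x)"
    by (rule Bochner_Integration.integrable_bound[OF v]) (auto simp: indicator_def)
  have i3: "integrable ?M (\<lambda>x. indicator {x. u x = 0} x *\<^sub>R \<bar>v x\<bar>)"
    by (rule Bochner_Integration.integrable_bound[OF v]) (auto simp: indicator_def)
  have "dir_deriv (j_Omega \<Omega>) u v =
      (\<integral>x. (if u x > 0 then v x else if u x < 0 then - v x else \<bar>v x\<bar>) \<partial>?M)"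
    unfolding dir_deriv_def j_Omega_def
    by (rule tendsto_Lim[OF _ L1_norm_directionally_differentiable[OF u v]]) simp
  also have "\<dots> = (\<integral>x. indicator {x. u x > 0} x *\<^sub>R v x - indicator {x. u x < 0} x *\<^sub>R v x
      + indicator {x. u x = 0} x *\<^sub>R \<bar>v x\<bar> \<partial>?M)"
    by (rule Bochner_Integration.integral_cong) (auto simp: indicator_def)
  finally show ?thesis
    unfolding set_lebesgue_integral_def using i1 i2 i3 by simp
qed

end

theory Submission
  imports Defs
begin

text \<open>
  Write \<open>f\<close> for the spatial \<open>L\<^sup>1\<close> norm of \<open>u_bar\<close> as a function of time, \<open>J\<close> for the \<open>L\<^sup>2\<close> norm of \<open>f\<close>, and \<open>E\<close>
  for the difference quotient of the spatial \<open>L\<^sup>1\<close> norm in direction \<open>v\<close> with step \<open>t\<close>. Then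
  \<open>j(u_bar + t v)\<^sup>2 = J\<^sup>2 + 2 t \<langle>f, E\<rangle> + t\<^sup>2 \<langle>E, E\<rangle>\<close> exactly, so the second-order quotient is governed by
  \<open>\<langle>E, E\<rangle> - (\<langle>f, E\<rangle> / J)\<^sup>2\<close>. Along a sequence with bounded quotients the first-order conditions force \<open>\<langle>f, E\<rangle>\<close> to
  converge to \<open>\<langle>f, D v\<rangle>\<close>, with \<open>D v\<close> the directional derivative, while \<open>E\<close> is asymptotically at least \<open>D v\<close> when
  tested with nonnegative functions; this gives the lower bound without any weak compactness argument.
  Truncating \<open>v\<close> where \<open>u_bar + t v\<close> leaves the box or may change sign makes \<open>E\<close> equal to the directional
  derivative, and yields the recovery sequence.
\<close>

subsection \<open>Square-integrable functions\<close>

lemma L2_measurable [measurable_dest]: "f \<in> L2 M \<Longrightarrow> f \<in> borel_measurable M"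
  and L2_integrable_square: "f \<in> L2 M \<Longrightarrow> integrable M (\<lambda>x. (f x)\<^sup>2)"
  by (auto simp: L2_def)

lemma L2_bound:
  assumes g: "g \<in> L2 M" and f: "f \<in> borel_measurable M" and le: "AE x in M. \<bar>f x\<bar> \<le> \<bar>g x\<bar>"
  shows "f \<in> L2 M"
proof -
  have "integrable M (\<lambda>x. (f x)\<^sup>2)"
    by (rule Bochner_Integration.integrable_bound[OF L2_integrable_square[OF g]])
      (use f le in \<open>auto simp: abs_le_square_iff elim!: eventually_mono\<close>)
  then show ?thesis using f by (simp add: L2_def)
qed

lemma L2_mult_integrable:
  assumes f: "f \<in> L2 M" and g: "g \<in> L2 M"
  shows "integrable M (\<lambda>x. f x * g x)"
proof (rule Bochner_Integration.integrable_bound)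
  show "integrable M (\<lambda>x. (f x)\<^sup>2 + (g x)\<^sup>2)"
    using f g by (simp add: L2_integrable_square)
  show "(\<lambda>x. f x * g x) \<in> borel_measurable M" using f g by measurable
  have "norm (a * b) \<le> norm (a\<^sup>2 + b\<^sup>2)" for a b :: real
  proof -
    have "0 \<le> \<bar>a\<bar> * \<bar>b\<bar>" by simp
    moreover have "2 * (\<bar>a\<bar> * \<bar>b\<bar>) \<le> a\<^sup>2 + b\<^sup>2"
      using sum_squares_bound[of "\<bar>a\<bar>" "\<bar>b\<bar>"] by (simp add: mult.assoc)
    ultimately have "\<bar>a\<bar> * \<bar>b\<bar> \<le> a\<^sup>2 + b\<^sup>2" by linarith
    then show ?thesis by (simp add: abs_mult)
  qed
  then show "AE x in M. norm (f x * g x) \<le> norm ((f x)\<^sup>2 + (g x)\<^sup>2)" by simp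
qed

lemma L2_scale: "f \<in> L2 M \<Longrightarrow> (\<lambda>x. c * f x) \<in> L2 M"
  by (auto simp: L2_def power_mult_distrib)

lemma L2_add:
  assumes f: "f \<in> L2 M" and g: "g \<in> L2 M"
  shows "(\<lambda>x. f x + g x) \<in> L2 M"
  using L2_mult_integrable[OF f g] f g by (auto simp: L2_def power2_sum mult.assoc)

lemma L2_uminus: "f \<in> L2 M \<Longrightarrow> (\<lambda>x. - f x) \<in> L2 M"
  by (auto simp: L2_def)

lemma L2_diff: "f \<in> L2 M \<Longrightarrow> g \<in> L2 M \<Longrightarrow> (\<lambda>x. f x - g x) \<in> L2 M"
  using L2_add[of f M "\<lambda>x. - g x"] L2_uminus[of g M] by simp

lemma L2_abs: "f \<in> L2 M \<Longrightarrow> (\<lambda>x. \<bar>f x\<bar>) \<in> L2 M"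
  by (auto simp: L2_def)

lemma L2_zero: "(\<lambda>x. 0) \<in> L2 M"
  by (auto simp: L2_def)

lemmas L2_intros = L2_scale L2_add L2_uminus L2_diff L2_abs L2_zero

lemma (in finite_measure) L2_integrable:
  assumes "f \<in> L2 M" shows "integrable M f"
proof -
  have "(\<lambda>x. 1) \<in> L2 M" by (simp add: L2_def)
  from L2_mult_integrable[OF assms this] show ?thesis by simp
qed

lemma L2_inner_commute: "L2_inner M f g = L2_inner M g f"
  by (simp add: L2_inner_def mult.commute)

lemma L2_inner_cong_AE:
  assumes "AE x in M. f x = f' x" "f \<in> borel_measurable M" "f' \<in> borel_measurable M"
    "g \<in> borel_measurable M"
  shows "L2_inner M f g = L2_inner M f' g"
  unfolding L2_inner_def by (rule integral_cong_AE) (use assms in auto)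

lemma L2_inner_add_left:
  "f \<in> L2 M \<Longrightarrow> g \<in> L2 M \<Longrightarrow> h \<in> L2 M \<Longrightarrow>
    L2_inner M (\<lambda>x. f x + g x) h = L2_inner M f h + L2_inner M g h"
  by (simp add: L2_inner_def distrib_right L2_mult_integrable)

lemma L2_inner_diff_left:
  "f \<in> L2 M \<Longrightarrow> g \<in> L2 M \<Longrightarrow> h \<in> L2 M \<Longrightarrow>
    L2_inner M (\<lambda>x. f x - g x) h = L2_inner M f h - L2_inner M g h"
  by (simp add: L2_inner_def left_diff_distrib L2_mult_integrable)

lemma L2_inner_scale_left: "L2_inner M (\<lambda>x. c * f x) h = c * L2_inner M f h"
  by (simp add: L2_inner_def mult.assoc)

lemma L2_inner_add_right:
  "f \<in> L2 M \<Longrightarrow> g \<in> L2 M \<Longrightarrow> h \<in> L2 M \<Longrightarrow>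
    L2_inner M h (\<lambda>x. f x + g x) = L2_inner M h f + L2_inner M h g"
  by (simp add: L2_inner_commute[of M h] L2_inner_add_left)

lemma L2_inner_diff_right:
  "f \<in> L2 M \<Longrightarrow> g \<in> L2 M \<Longrightarrow> h \<in> L2 M \<Longrightarrow>
    L2_inner M h (\<lambda>x. f x - g x) = L2_inner M h f - L2_inner M h g"
  by (simp add: L2_inner_commute[of M h] L2_inner_diff_left)

lemma L2_inner_scale_right: "L2_inner M h (\<lambda>x. c * f x) = c * L2_inner M h f"
  by (simp add: L2_inner_commute[of M h] L2_inner_scale_left)

lemma L2_inner_self_nonneg: "L2_inner M f f \<ge> 0"
  by (simp add: L2_inner_def)

lemma L2_norm_inner: "L2_norm M f = sqrt (L2_inner M f f)"
  by (simp add: L2_norm_def L2_inner_def power2_eq_square)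

lemma L2_inner_self_mono:
  assumes "f \<in> L2 M" "g \<in> L2 M" "AE x in M. \<bar>f x\<bar> \<le> \<bar>g x\<bar>"
  shows "L2_inner M f f \<le> L2_inner M g g"
  unfolding L2_inner_def power2_eq_square[symmetric]
  by (rule integral_mono_AE)
    (use assms in \<open>auto simp: L2_integrable_square abs_le_square_iff\<close>)

lemma L2_inner_self_add_scaled:
  assumes f: "f \<in> L2 M" and g: "g \<in> L2 M"
  shows "L2_inner M (\<lambda>x. f x + s * g x) (\<lambda>x. f x + s * g x)
    = L2_inner M f f + 2 * s * L2_inner M f g + s\<^sup>2 * L2_inner M g g"
  using f g by (simp add: L2_inner_add_left L2_inner_add_right L2_inner_scale_left
      L2_inner_scale_right L2_intros L2_inner_commute[of M g f] algebra_simps power2_eq_square)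

lemma L2_Cauchy_Schwarz:
  assumes f: "f \<in> L2 M" and g: "g \<in> L2 M"
  shows "(L2_inner M f g)\<^sup>2 \<le> L2_inner M f f * L2_inner M g g"
proof -
  let ?a = "L2_inner M f f" and ?b = "L2_inner M f g" and ?c = "L2_inner M g g"
  have *: "0 \<le> ?a + 2 * s * ?b + s\<^sup>2 * ?c" for s
    using L2_inner_self_add_scaled[OF f g, of s] L2_inner_self_nonneg by metis
  show ?thesis
  proof (cases "?c = 0")
    case True
    have "?b = 0"
    proof (rule ccontr)
      assume "?b \<noteq> 0"
      \<comment> \<open>With \<open>?c = 0\<close> the quadratic is affine in \<open>s\<close>, and
        this \<open>s\<close> gives it the value -1.\<close>
      then have "2 * (- (?a + 1) / (2 * ?b)) * ?b = - (?a + 1)" by simp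
      then show False using *[of "- (?a + 1) / (2 * ?b)"] True by simp
    qed
    then show ?thesis using True by simp
  next
    case False
    then have c: "?c > 0" using L2_inner_self_nonneg[of M g] by simp
    \<comment> \<open>The quadratic is evaluated at its minimiser.\<close>
    have "0 \<le> ?a - ?b\<^sup>2 / ?c"
      using *[of "- ?b / ?c"] c by (simp add: field_simps power2_eq_square)
    then show ?thesis using c by (simp add: field_simps)
  qed
qed

lemma L2_norm_nonneg: "L2_norm M f \<ge> 0"
  by (simp add: L2_norm_def)

lemma L2_norm_power2: "(L2_norm M f)\<^sup>2 = L2_inner M f f"
  by (simp add: L2_norm_inner L2_inner_self_nonneg)

lemma abs_L2_inner_le:
  assumes "f \<in> L2 M" "g \<in> L2 M"
  shows "\<bar>L2_inner M f g\<bar> \<le> L2_norm M f * L2_norm M g"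
  using real_sqrt_le_mono[OF L2_Cauchy_Schwarz[OF assms]]
  by (simp add: L2_norm_inner real_sqrt_mult)

lemma L2_strong_convD:
  assumes "L2_strong_conv M vs v"
  shows "vs k \<in> L2 M" "v \<in> L2 M" "(\<lambda>k. L2_norm M (\<lambda>x. vs k x - v x)) \<longlonglongrightarrow> 0"
  using assms by (auto simp: L2_strong_conv_def)

lemma L2_strong_imp_inner:
  assumes vs: "L2_strong_conv M vs v" and g: "g \<in> L2 M"
  shows "(\<lambda>k. L2_inner M (vs k) g) \<longlonglongrightarrow> L2_inner M v g"
proof (rule Lim_transform2[OF tendsto_const])
  note [simp] = L2_strong_convD(1,2)[OF vs]
  show "(\<lambda>k. L2_inner M v g - L2_inner M (vs k) g) \<longlonglongrightarrow> 0"
  proof (rule Lim_null_comparison)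
    show "\<forall>\<^sub>F k in sequentially. norm (L2_inner M v g - L2_inner M (vs k) g)
        \<le> L2_norm M (\<lambda>x. vs k x - v x) * L2_norm M g"
      using abs_L2_inner_le[of "\<lambda>x. vs k x - v x" M g for k] g
      by (auto simp: L2_inner_diff_left L2_diff abs_minus_commute)
    show "(\<lambda>k. L2_norm M (\<lambda>x. vs k x - v x) * L2_norm M g) \<longlonglongrightarrow> 0"
      by (rule tendsto_mult_left_zero[OF L2_strong_convD(3)[OF vs]])
  qed
qed

lemma L2_strong_imp_weak: "L2_strong_conv M vs v \<Longrightarrow> L2_weak_conv M vs v"
  unfolding L2_weak_conv_def using L2_strong_imp_inner L2_strong_convD by blast

text \<open>Expanding the square of \<open>vs k - v\<close> expresses the square of
  \<open>vs k\<close> through terms whose limits are known.\<close>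

lemma L2_strong_imp_inner_self:
  assumes vs: "L2_strong_conv M vs v"
  shows "(\<lambda>k. L2_inner M (vs k) (vs k)) \<longlonglongrightarrow> L2_inner M v v"
proof -
  note [simp] = L2_strong_convD(1,2)[OF vs]
  have "(\<lambda>k. 2 * L2_inner M (vs k) v + (L2_norm M (\<lambda>x. vs k x - v x))\<^sup>2 - L2_inner M v v)
      \<longlonglongrightarrow> 2 * L2_inner M v v + 0\<^sup>2 - L2_inner M v v"
    by (intro tendsto_intros L2_strong_imp_inner[OF vs] L2_strong_convD(3)[OF vs]) simp
  then show ?thesis
    by (simp add: L2_norm_power2 L2_inner_diff_left L2_inner_diff_right L2_diff
        L2_inner_commute[of M v "vs k" for k] algebra_simps)
qed

lemma L2_strong_conv_const: "v \<in> L2 M \<Longrightarrow> L2_strong_conv M (\<lambda>k. v) v"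
  by (simp add: L2_strong_conv_def L2_norm_def)

lemma L2_dominated_convergence:
  assumes g: "g \<in> L2 M" and v: "v \<in> L2 M" and m: "\<And>k. vs k \<in> borel_measurable M"
    and le: "\<And>k. AE x in M. \<bar>vs k x\<bar> \<le> \<bar>g x\<bar>" and lim: "AE x in M. (\<lambda>k. vs k x) \<longlonglongrightarrow> v x"
  shows "L2_strong_conv M vs v"
proof -
  have [measurable]: "v \<in> borel_measurable M" "\<And>k. vs k \<in> borel_measurable M" using v m by auto
  have "(\<lambda>k. \<integral>x. (vs k x - v x)\<^sup>2 \<partial>M) \<longlonglongrightarrow> (\<integral>x. 0 \<partial>M)"
  proof (rule integral_dominated_convergence[where w = "\<lambda>x. (\<bar>g x\<bar> + \<bar>v x\<bar>)\<^sup>2"])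
    show "integrable M (\<lambda>x. (\<bar>g x\<bar> + \<bar>v x\<bar>)\<^sup>2)"
      by (intro L2_integrable_square L2_intros g v)
    show "AE x in M. (\<lambda>k. (vs k x - v x)\<^sup>2) \<longlonglongrightarrow> 0"
      using lim by eventually_elim (auto intro!: tendsto_eq_intros)
    show "AE x in M. norm ((vs k x - v x)\<^sup>2) \<le> (\<bar>g x\<bar> + \<bar>v x\<bar>)\<^sup>2" for k
      using le[of k]
    proof eventually_elim
      case (elim x)
      then have "\<bar>vs k x - v x\<bar> \<le> \<bar>g x\<bar> + \<bar>v x\<bar>" by linarith
      then show ?case by (simp add: abs_le_square_iff[symmetric])
    qed
  qed auto
  from tendsto_real_sqrt[OF this] show ?thesis
    unfolding L2_strong_conv_def L2_norm_def
    using v L2_bound[OF g m le] by simp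
qed

text \<open>Joint measurability in \<open>z\<close> makes the slices integrable only for almost every second coordinate;
  elsewhere the Bochner integral takes the junk value 0.\<close>

definition slice_integral :: "'a measure \<Rightarrow> ('a \<times> 'b \<Rightarrow> real) \<Rightarrow> 'b \<Rightarrow> real" where
  "slice_integral A h t = (\<integral>x. h (x, t) \<partial>A)"

section \<open>Slicing on a product of two finite measure spaces\<close>

locale finite_product = A: finite_measure A + B: finite_measure B
  for A :: "'a measure" and B :: "'b measure"
begin

sublocale pair_sigma_finite A B ..

abbreviation Q :: "('a \<times> 'b) measure" where "Q \<equiv> A \<Otimes>\<^sub>M B"

abbreviation S :: "('a \<times> 'b \<Rightarrow> real) \<Rightarrow> 'b \<Rightarrow> real" where "S \<equiv> slice_integral A"

sublocale Q: finite_measure Q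
  by (rule finite_measure_pair_measure) unfold_locales

lemma slice_measurable [measurable]: "h \<in> borel_measurable Q \<Longrightarrow> S h \<in> borel_measurable B"
  unfolding slice_integral_def
  by (rule A.borel_measurable_lebesgue_integral) (use measurable_pair_swap[of h A B borel] in simp)

lemma slice_integrable:
  assumes "h \<in> L2 Q"
  shows "AE t in B. integrable A (\<lambda>x. h (x, t))"
  using AE_integrable_snd[of "curry h"] Q.L2_integrable[OF assms] by simp

lemma slice_L2:
  assumes "h \<in> L2 Q"
  shows "AE t in B. (\<lambda>x. h (x, t)) \<in> L2 A"
proof -
  have [measurable]: "h \<in> borel_measurable Q" using assms by simp
  have "AE t in B. integrable A (\<lambda>x. (h (x, t))\<^sup>2)"
    using AE_integrable_snd[of "\<lambda>x t. (h (x, t))\<^sup>2"] L2_integrable_square[OF assms] by (simp add: case_prod_beta')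
  moreover have "AE t in B. (\<lambda>x. h (x, t)) \<in> borel_measurable A" by (rule AE_I2) measurable
  ultimately show ?thesis by eventually_elim (simp add: L2_def)
qed

lemma slice_add:
  assumes "f \<in> L2 Q" "g \<in> L2 Q"
  shows "AE t in B. S (\<lambda>z. f z + c * g z) t = S f t + c * S g t"
  using slice_integrable[OF assms(1)] slice_integrable[OF assms(2)]
  by eventually_elim (simp add: slice_integral_def)

lemma slice_mono:
  assumes "f \<in> L2 Q" "g \<in> L2 Q" "\<And>z. f z \<le> g z"
  shows "AE t in B. S f t \<le> S g t"
  using slice_integrable[OF assms(1)] slice_integrable[OF assms(2)]
  by eventually_elim (auto simp: slice_integral_def intro!: integral_mono assms(3))

text \<open>Cauchy-Schwarz on the slice against the constant 1; finiteness of \<open>A\<close>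
  enters here.\<close>

lemma slice_square_le:
  assumes "h \<in> L2 Q"
  shows "AE t in B. (S h t)\<^sup>2 \<le> measure A (space A) * (\<integral>x. (h (x, t))\<^sup>2 \<partial>A)"
  using slice_L2[OF assms]
proof eventually_elim
  case (elim t)
  have "(\<lambda>x. 1) \<in> L2 A" by (simp add: L2_def)
  from L2_Cauchy_Schwarz[OF elim this] show ?case
    by (simp add: L2_inner_def slice_integral_def power2_eq_square mult.commute)
qed

lemma slice_in_L2:
  assumes h: "h \<in> L2 Q"
  shows "S h \<in> L2 B" and "L2_inner B (S h) (S h) \<le> measure A (space A) * L2_inner Q h h"
proof -
  have [measurable]: "h \<in> borel_measurable Q" using h by simp
  have sq: "integrable Q (\<lambda>(x, t). (h (x, t))\<^sup>2)"
    using L2_integrable_square[OF h] by (simp add: case_prod_beta')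
  let ?b = "\<lambda>t. measure A (space A) * (\<integral>x. (h (x, t))\<^sup>2 \<partial>A)"
  have b: "integrable B ?b"
    by (rule integrable_mult_right[OF integrable_snd[OF sq]])
  have i: "integrable B (\<lambda>t. (S h t)\<^sup>2)"
    by (rule Bochner_Integration.integrable_bound[OF b])
      (use slice_square_le[OF h] in \<open>auto elim!: eventually_mono\<close>)
  then show "S h \<in> L2 B" by (simp add: L2_def)
  have "(\<integral>t. (S h t)\<^sup>2 \<partial>B) \<le> integral\<^sup>L B ?b"
    by (rule integral_mono_AE[OF i b slice_square_le[OF h]])
  also have "\<dots> = measure A (space A) * (\<integral>z. (h z)\<^sup>2 \<partial>Q)"
    using integral_snd[OF sq] by (simp add: case_prod_beta')
  finally show "L2_inner B (S h) (S h) \<le> measure A (space A) * L2_inner Q h h"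
    by (simp add: L2_inner_def power2_eq_square)
qed

lemma L2_snd:
  assumes p: "p \<in> L2 B"
  shows "(\<lambda>z. p (snd z)) \<in> L2 Q"
proof -
  have [measurable]: "p \<in> borel_measurable B" using p by simp
  have "integrable Q (\<lambda>z. (p (snd z))\<^sup>2)"
  proof (rule Fubini_integrable)
    show "integrable A (\<lambda>x. \<integral>y. norm ((p (snd (x, y)))\<^sup>2) \<partial>B)" by simp
    show "AE x in A. integrable B (\<lambda>y. (p (snd (x, y)))\<^sup>2)"
      using L2_integrable_square[OF p] by simp
  qed measurable
  then show ?thesis by (simp add: L2_def)
qed

text \<open>The adjoint of slicing is composition with \<open>snd\<close>; pairings in time thereby
  become pairings on \<open>Q\<close>, where weak convergence is given.\<close>

lemma L2_inner_slice:
  assumes p: "p \<in> L2 B" and h: "h \<in> L2 Q"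
  shows "L2_inner B (S h) p = L2_inner Q h (\<lambda>z. p (snd z))"
proof -
  have "integrable Q (\<lambda>(x, t). h (x, t) * p t)"
    using L2_mult_integrable[OF h L2_snd[OF p]] by (simp add: case_prod_beta')
  from integral_snd[OF this] show ?thesis
    by (simp add: L2_inner_def slice_integral_def case_prod_beta')
qed

text \<open>Slicing is bounded from \<open>L2 Q\<close> to \<open>L2 B\<close>, but linear only up
  to null sets of times, so the difference of slices is first replaced by the slice of the
  difference.\<close>

lemma slice_strong_conv:
  assumes hs: "L2_strong_conv Q hs h"
  shows "L2_strong_conv B (\<lambda>k. S (hs k)) (S h)"
proof -
  note L = L2_strong_convD(1,2)[OF hs]
  let ?d = "\<lambda>k z. hs k z - h z" and ?c = "sqrt (measure A (space A))"
  have "L2_norm B (\<lambda>t. S (hs k) t - S h t) \<le> ?c * L2_norm Q (?d k)" for k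
  proof -
    have "AE t in B. S (hs k) t - S h t = S (?d k) t"
      using slice_add[OF L(1)[of k] L(2), of "-1"] by eventually_elim simp
    then have "(\<integral>t. (S (hs k) t - S h t)\<^sup>2 \<partial>B) = (\<integral>t. (S (?d k) t)\<^sup>2 \<partial>B)"
      using L by (intro integral_cong_AE) (auto elim!: eventually_mono)
    also have "\<dots> \<le> measure A (space A) * L2_inner Q (?d k) (?d k)"
      using slice_in_L2(2)[OF L2_diff[OF L(1) L(2), of k]] by (simp add: L2_inner_def power2_eq_square)
    finally show ?thesis
      unfolding L2_norm_inner real_sqrt_mult[symmetric]
      by (intro real_sqrt_le_mono) (simp add: L2_inner_def power2_eq_square)
  qed
  then have "(\<lambda>k. L2_norm B (\<lambda>t. S (hs k) t - S h t)) \<longlonglongrightarrow> 0"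
    by (intro Lim_null_comparison[OF _ tendsto_mult_right_zero[OF L2_strong_convD(3)[OF hs]]])
      (auto intro!: always_eventually simp: L2_norm_nonneg)
  then show ?thesis
    using L slice_in_L2 unfolding L2_strong_conv_def by blast
qed

end

subsection \<open>The mixed norm and its difference quotients\<close>

definition dir_sign :: "real \<Rightarrow> real \<Rightarrow> real" where
  "dir_sign a b = (if a > 0 then 1 else if a < 0 then -1 else sgn b)"

definition abs_deriv :: "real \<Rightarrow> real \<Rightarrow> real" where
  "abs_deriv a b = (if a > 0 then b else if a < 0 then - b else \<bar>b\<bar>)"

definition abs_quot :: "real \<Rightarrow> real \<Rightarrow> real \<Rightarrow> real" where
  "abs_quot t a b = (\<bar>a + t * b\<bar> - \<bar>a\<bar>) / t"

lemma dir_sign_measurable [measurable]: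
  assumes [measurable]: "f \<in> borel_measurable M" "g \<in> borel_measurable M"
  shows "(\<lambda>x. dir_sign (f x) (g x)) \<in> borel_measurable M"
  unfolding dir_sign_def by measurable

lemma abs_deriv_measurable [measurable]:
  assumes [measurable]: "f \<in> borel_measurable M" "g \<in> borel_measurable M"
  shows "(\<lambda>x. abs_deriv (f x) (g x)) \<in> borel_measurable M"
  unfolding abs_deriv_def by measurable

lemma abs_quot_measurable [measurable]:
  assumes [measurable]: "f \<in> borel_measurable M" "g \<in> borel_measurable M"
  shows "(\<lambda>x. abs_quot t (f x) (g x)) \<in> borel_measurable M"
  unfolding abs_quot_def by measurable

lemma abs_dir_sign_le: "\<bar>dir_sign a b\<bar> \<le> 1"
  by (auto simp: dir_sign_def sgn_if)

text \<open>\<open>dir_sign a b\<close> is a subgradient of the absolute value at \<open>a\<close>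
  that attains the derivative in direction \<open>b\<close>.\<close>

lemma abs_deriv_dir_sign: "abs_deriv a b = b * dir_sign a b"
  by (auto simp: dir_sign_def abs_deriv_def sgn_if)

lemma abs_abs_deriv_le: "\<bar>abs_deriv a b\<bar> \<le> \<bar>b\<bar>"
  by (auto simp: abs_deriv_def)

lemma abs_deriv_lipschitz: "\<bar>abs_deriv a b - abs_deriv a c\<bar> \<le> \<bar>b - c\<bar>"
  by (auto simp: abs_deriv_def)

lemma abs_abs_quot_le: "t > 0 \<Longrightarrow> \<bar>abs_quot t a b\<bar> \<le> \<bar>b\<bar>"
  using abs_triangle_ineq3[of "a + t * b" a]
  by (simp add: abs_quot_def abs_mult pos_divide_le_eq mult.commute)

text \<open>Subgradient inequality: the sign has modulus at most 1, and its product with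
  \<open>a\<close> is the absolute value of \<open>a\<close>.\<close>

lemma dir_sign_le_abs_quot:
  assumes "t > 0" shows "c * dir_sign a b \<le> abs_quot t a c"
proof -
  have "(a + t * c) * dir_sign a b \<le> \<bar>a + t * c\<bar>"
    using mult_left_mono[OF abs_dir_sign_le[of a b], of "\<bar>a + t * c\<bar>"]
      abs_ge_self[of "(a + t * c) * dir_sign a b"] by (simp add: abs_mult)
  moreover have "a * dir_sign a b = \<bar>a\<bar>"
    by (auto simp: dir_sign_def)
  ultimately show ?thesis
    using assms by (simp add: abs_quot_def field_simps)
qed

text \<open>The absolute value is affine on each half-line, and the condition keeps
  \<open>a + t * b\<close> on the side of \<open>a\<close>; at \<open>a = 0\<close> positive
  homogeneity suffices.\<close>

lemma abs_quot_exact: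
  assumes "t > 0" "a = 0 \<or> \<bar>t * b\<bar> \<le> \<bar>a\<bar>"
  shows "abs_quot t a b = abs_deriv a b"
proof (cases "a = 0")
  case True
  then show ?thesis using assms(1) by (simp add: abs_quot_def abs_deriv_def abs_mult)
next
  case False
  then have "\<bar>a + t * b\<bar> - \<bar>a\<bar> = t * abs_deriv a b"
    using assms(2) by (auto simp: abs_deriv_def)
  then show ?thesis using assms(1) by (simp add: abs_quot_def)
qed

lemma eventually_small_multiple:
  fixes a b :: real
  assumes "t \<longlonglongrightarrow> 0" "a \<noteq> 0"
  shows "\<forall>\<^sub>F k in sequentially. \<bar>t k * b\<bar> \<le> \<bar>a\<bar>"
proof -
  have "(\<lambda>k. \<bar>t k * b\<bar>) \<longlonglongrightarrow> \<bar>0 * b\<bar>"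
    using assms(1) by (intro tendsto_intros)
  from order_tendstoD(2)[OF this, of "\<bar>a\<bar>"] assms(2) show ?thesis
    by (auto elim!: eventually_mono)
qed

lemma abs_quot_tendsto:
  assumes "\<And>k. t k > 0" "t \<longlonglongrightarrow> 0"
  shows "(\<lambda>k. abs_quot (t k) a b) \<longlonglongrightarrow> abs_deriv a b"
proof (rule tendsto_eventually)
  have "\<forall>\<^sub>F k in sequentially. a = 0 \<or> \<bar>t k * b\<bar> \<le> \<bar>a\<bar>"
    using eventually_small_multiple[OF assms(2), of a b] by (cases "a = 0") auto
  then show "\<forall>\<^sub>F k in sequentially. abs_quot (t k) a b = abs_deriv a b"
    by eventually_elim (simp add: abs_quot_exact assms(1))
qed

text \<open>Convexity: the shorter step is a convex combination of \<open>a\<close> and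
  \<open>a + t * b\<close>. This lets \<open>first_order\<close> shrink the step while keeping the
  quotient of size \<open>t\<close>.\<close>

lemma abs_add_scaled_le:
  assumes "t > 0" "0 \<le> s" "s \<le> (1::real)"
  shows "\<bar>a + s * t * b\<bar> \<le> \<bar>a\<bar> + s * t * abs_quot t a b"
proof -
  have "\<bar>a + s * t * b\<bar> = \<bar>(1 - s) * a + s * (a + t * b)\<bar>" by (simp add: algebra_simps)
  also have "\<dots> \<le> (1 - s) * \<bar>a\<bar> + s * \<bar>a + t * b\<bar>"
    using abs_triangle_ineq[of "(1 - s) * a" "s * (a + t * b)"] assms by (simp add: abs_mult)
  also have "\<dots> = \<bar>a\<bar> + s * t * abs_quot t a b"
  proof -
    have *: "t * abs_quot t a b = \<bar>a + t * b\<bar> - \<bar>a\<bar>" using assms(1) by (simp add: abs_quot_def)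
    show ?thesis unfolding mult.assoc[of s t] * by (simp add: algebra_simps)
  qed
  finally show ?thesis .
qed

lemma nonneg_of_affine_nonneg:
  fixes a b t :: real
  assumes "t > 0" and nn: "\<And>x. 0 < x \<Longrightarrow> x \<le> t \<Longrightarrow> 0 \<le> a + x * b"
  shows "0 \<le> a"
proof (rule ccontr)
  assume a: "\<not> 0 \<le> a"
  \<comment> \<open>Small enough that \<open>x * b\<close> is at most \<open>- a / 2\<close>; the
    summand 1 keeps the denominator positive when \<open>b = 0\<close>.\<close>
  define x where "x = min t (- a / (2 * (\<bar>b\<bar> + 1)))"
  have x: "0 < x" "x \<le> t" using a assms(1) by (auto simp: x_def field_simps)
  have "x * b \<le> x * (\<bar>b\<bar> + 1)" using x by (intro mult_left_mono) auto
  also have "\<dots> \<le> - a / (2 * (\<bar>b\<bar> + 1)) * (\<bar>b\<bar> + 1)" by (intro mult_right_mono) (auto simp: x_def)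
  also have "- a / (2 * (\<bar>b\<bar> + 1)) * (\<bar>b\<bar> + 1) = - a / 2"
  proof -
    have "- a / (2 * c) * c = - a / 2" if "c > 0" for c using that by simp
    from this[of "\<bar>b\<bar> + 1"] show ?thesis by simp
  qed
  finally show False using nn[OF x] a by simp
qed

text \<open>Two finite measure spaces stand for the domain and the time interval.
  \<open>subgrad\<close> says that \<open>- F1\<close> is a subgradient, stated for feasible
  \<open>z\<close> only, since the functional is infinite elsewhere.\<close>

locale sparse_box_problem = finite_product A B
  for A :: "'a measure" and B :: "'b measure" +
  fixes \<alpha> \<beta> \<mu> :: real and u_bar F1 :: "'a \<times> 'b \<Rightarrow> real"
  assumes \<mu>: "\<mu> > 0"
    and u_bar: "u_bar \<in> L2 Q" and u_bar_box: "AE z in Q. \<alpha> \<le> u_bar z \<and> u_bar z \<le> \<beta>"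
    and F1: "F1 \<in> L2 Q"
    and subgrad: "\<And>z. z \<in> L2 Q \<Longrightarrow> AE x in Q. \<alpha> \<le> z x \<and> z x \<le> \<beta> \<Longrightarrow>
      \<mu> * L2_norm B (S (\<lambda>z. \<bar>u_bar z\<bar>)) \<le>
        \<mu> * L2_norm B (S (\<lambda>x. \<bar>z x\<bar>)) + L2_inner Q F1 (\<lambda>x. z x - u_bar x)"
begin

section \<open>The mixed norm, its derivative and its exact expansion\<close>

definition j :: "('a \<times> 'b \<Rightarrow> real) \<Rightarrow> real" where
  "j u = L2_norm B (S (\<lambda>z. \<bar>u z\<bar>))"

definition U :: "('a \<times> 'b \<Rightarrow> real) set" where
  "U = {u \<in> L2 Q. AE z in Q. \<alpha> \<le> u z \<and> u z \<le> \<beta>}"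

definition Tan :: "('a \<times> 'b \<Rightarrow> real) set" where
  "Tan = {v \<in> L2 Q. AE z in Q. (u_bar z = \<alpha> \<longrightarrow> v z \<ge> 0) \<and> (u_bar z = \<beta> \<longrightarrow> v z \<le> 0)}"

definition f :: "'b \<Rightarrow> real" where "f = S (\<lambda>z. \<bar>u_bar z\<bar>)"

definition J :: real where "J = j u_bar"

definition D :: "('a \<times> 'b \<Rightarrow> real) \<Rightarrow> 'b \<Rightarrow> real" where
  "D v = S (\<lambda>z. abs_deriv (u_bar z) (v z))"

definition E :: "real \<Rightarrow> ('a \<times> 'b \<Rightarrow> real) \<Rightarrow> 'b \<Rightarrow> real" where
  "E t v = S (\<lambda>z. abs_quot t (u_bar z) (v z))"

text \<open>The directional derivative of \<open>j\<close> at \<open>u_bar\<close>, as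
  \<open>dir_deriv_j\<close> shows: the L2 norm in time is differentiable at \<open>f\<close> if
  \<open>J\<close> is positive, and at 0 its directional derivative is the norm itself.\<close>

definition dj :: "('a \<times> 'b \<Rightarrow> real) \<Rightarrow> real" where
  "dj v = (if J = 0 then L2_norm B (D v) else L2_inner B f (D v) / J)"

text \<open>The box clause makes the step of size \<open>t\<close> feasible, the last clause makes
  its difference quotient exact. Setting values to 0 instead of clipping them gives
  \<open>trunc t v\<close> and the remainder disjoint supports, as \<open>trunc_critical\<close>
  requires.\<close>

definition trunc :: "real \<Rightarrow> ('a \<times> 'b \<Rightarrow> real) \<Rightarrow> 'a \<times> 'b \<Rightarrow> real" where
  "trunc t v z = (if \<alpha> \<le> u_bar z + t * v z \<and> u_bar z + t * v z \<le> \<beta> \<and>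
     (u_bar z = 0 \<or> \<bar>t * v z\<bar> \<le> \<bar>u_bar z\<bar>) then v z else 0)"

lemma u_bar_measurable [measurable]: "u_bar \<in> borel_measurable Q"
  using u_bar by simp

lemma f_L2: "f \<in> L2 B"
  unfolding f_def by (intro slice_in_L2 L2_intros u_bar)

lemma f_nonneg: "f t \<ge> 0"
  by (simp add: f_def slice_integral_def)

lemma J_eq: "J = L2_norm B f"
  by (simp add: J_def j_def f_def)

lemma J_nonneg: "J \<ge> 0"
  by (simp add: J_eq L2_norm_nonneg)

lemma L2_inner_f_f: "L2_inner B f f = J\<^sup>2"
  by (simp add: J_eq L2_norm_power2)

lemma j_nonneg: "j u \<ge> 0"
  by (simp add: j_def L2_norm_nonneg)

lemma deriv_L2:
  assumes "v \<in> L2 Q" shows "(\<lambda>z. abs_deriv (u_bar z) (v z)) \<in> L2 Q"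
  by (rule L2_bound[OF assms]) (use assms in \<open>auto simp: abs_abs_deriv_le\<close>)

lemma quot_L2:
  assumes "v \<in> L2 Q" "t > 0" shows "(\<lambda>z. abs_quot t (u_bar z) (v z)) \<in> L2 Q"
  by (rule L2_bound[OF assms(1)]) (use assms in \<open>auto simp: abs_abs_quot_le\<close>)

lemma D_L2: "v \<in> L2 Q \<Longrightarrow> D v \<in> L2 B"
  unfolding D_def by (intro slice_in_L2 deriv_L2)

lemma E_L2: "v \<in> L2 Q \<Longrightarrow> t > 0 \<Longrightarrow> E t v \<in> L2 B"
  unfolding E_def by (intro slice_in_L2 quot_L2)

lemma slice_abs_expand:
  assumes v: "v \<in> L2 Q" and t: "t > 0"
  shows "AE s in B. S (\<lambda>z. \<bar>u_bar z + t * v z\<bar>) s = f s + t * E t v s"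
proof -
  have "(\<lambda>z. \<bar>u_bar z + t * v z\<bar>) = (\<lambda>z. \<bar>u_bar z\<bar> + t * abs_quot t (u_bar z) (v z))"
    using t by (auto simp: abs_quot_def)
  then show ?thesis
    using slice_add[OF L2_abs[OF u_bar] quot_L2[OF v t], of t] by (simp add: f_def E_def)
qed

lemma j_expand:
  assumes v: "v \<in> L2 Q" and t: "t > 0"
  shows "(j (\<lambda>z. u_bar z + t * v z))\<^sup>2
    = J\<^sup>2 + 2 * t * L2_inner B f (E t v) + t\<^sup>2 * L2_inner B (E t v) (E t v)"
proof -
  have [measurable]: "S (\<lambda>z. \<bar>u_bar z + t * v z\<bar>) \<in> borel_measurable B"
    "f \<in> borel_measurable B" "E t v \<in> borel_measurable B"
    using v t f_L2 E_L2 by auto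
  have "(j (\<lambda>z. u_bar z + t * v z))\<^sup>2
      = (\<integral>s. S (\<lambda>z. \<bar>u_bar z + t * v z\<bar>) s * S (\<lambda>z. \<bar>u_bar z + t * v z\<bar>) s \<partial>B)"
    by (simp add: j_def L2_norm_power2 L2_inner_def)
  also have "\<dots> = L2_inner B (\<lambda>s. f s + t * E t v s) (\<lambda>s. f s + t * E t v s)"
    unfolding L2_inner_def
    by (rule integral_cong_AE) (use slice_abs_expand[OF v t] in \<open>auto elim!: eventually_mono\<close>)
  finally show ?thesis
    by (simp add: L2_inner_self_add_scaled f_L2 E_L2 v t L2_inner_f_f)
qed

text \<open>The left side is the tangent of the Hilbert norm at \<open>f\<close>. After squaring,
  the claim is Cauchy-Schwarz; only the right side has to be nonnegative for that.\<close>

lemma j_linear_lower: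
  assumes v: "v \<in> L2 Q" and t: "t > 0" and J: "J > 0"
  shows "J + t * (L2_inner B f (E t v) / J) \<le> j (\<lambda>z. u_bar z + t * v z)"
proof (rule power2_le_imp_le)
  have "(L2_inner B f (E t v))\<^sup>2 \<le> J\<^sup>2 * L2_inner B (E t v) (E t v)"
    using L2_Cauchy_Schwarz[OF f_L2 E_L2[OF v t]] by (simp add: L2_inner_f_f)
  then have "(L2_inner B f (E t v))\<^sup>2 / J\<^sup>2 \<le> L2_inner B (E t v) (E t v)"
    using J by (simp add: field_simps)
  then have "t\<^sup>2 * ((L2_inner B f (E t v))\<^sup>2 / J\<^sup>2) \<le> t\<^sup>2 * L2_inner B (E t v) (E t v)"
    by (intro mult_left_mono) auto
  then show "(J + t * (L2_inner B f (E t v) / J))\<^sup>2 \<le> (j (\<lambda>z. u_bar z + t * v z))\<^sup>2"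
    using J unfolding j_expand[OF v t] by (simp add: power2_sum power_mult_distrib power_divide)
qed (rule j_nonneg)

lemma j_zero:
  assumes v: "v \<in> L2 Q" and t: "t > 0" and J: "J = 0"
  shows "j (\<lambda>z. u_bar z + t * v z) = t * L2_norm B (E t v)"
proof -
  \<comment> \<open>\<open>f\<close> has norm 0, so the linear term of \<open>j_expand\<close>
    vanishes.\<close>
  have "L2_inner B f (E t v) = 0"
    using abs_L2_inner_le[OF f_L2 E_L2[OF v t]] J by (simp add: J_eq[symmetric])
  then have "(j (\<lambda>z. u_bar z + t * v z))\<^sup>2 = (t * L2_norm B (E t v))\<^sup>2"
    using j_expand[OF v t] J by (simp add: power_mult_distrib L2_norm_power2)
  then show ?thesis
    using t by (simp add: power2_eq_iff_nonneg j_nonneg L2_norm_nonneg)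
qed

section \<open>Feasible steps and the first-order condition\<close>

lemma Tan_L2: "v \<in> Tan \<Longrightarrow> v \<in> L2 Q"
  by (simp add: Tan_def)

lemma u_bar_U: "u_bar \<in> U"
  using u_bar u_bar_box by (simp add: U_def)

lemma subgradient_step:
  assumes v: "v \<in> L2 Q" and "t > 0" and "(\<lambda>z. u_bar z + t * v z) \<in> U"
  shows "\<mu> * J \<le> \<mu> * j (\<lambda>z. u_bar z + t * v z) + t * L2_inner Q F1 v"
  using subgrad[of "\<lambda>z. u_bar z + t * v z"] assms
  by (simp add: U_def j_def J_def L2_inner_scale_right)

lemma U_convex:
  assumes v: "v \<in> L2 Q" and "(\<lambda>z. u_bar z + t * v z) \<in> U" and s: "0 \<le> s" "s \<le> 1"
  shows "(\<lambda>z. u_bar z + s * t * v z) \<in> U"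
proof -
  have "AE z in Q. \<alpha> \<le> u_bar z + t * v z \<and> u_bar z + t * v z \<le> \<beta>"
    using assms(2) by (simp add: U_def)
  then have "AE z in Q. \<alpha> \<le> u_bar z + s * t * v z \<and> u_bar z + s * t * v z \<le> \<beta>"
    using u_bar_box
  proof eventually_elim
    case (elim z)
    have *: "u_bar z + s * t * v z = (1 - s) * u_bar z + s * (u_bar z + t * v z)"
      by (simp add: algebra_simps)
    have "(1 - s) * \<alpha> + s * \<alpha> \<le> u_bar z + s * t * v z"
      unfolding * using elim s by (intro add_mono mult_left_mono) auto
    moreover have "u_bar z + s * t * v z \<le> (1 - s) * \<beta> + s * \<beta>"
      unfolding * using elim s by (intro add_mono mult_left_mono) auto
    ultimately show ?case by (simp add: algebra_simps)
  qed
  then show ?thesis using L2_add[OF u_bar L2_scale[OF v, of "s * t"]] by (simp add: U_def)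
qed

text \<open>Linearising \<open>sqrt\<close> at \<open>J\<^sup>2\<close> along the segment to \<open>u_bar + t v\<close> gives the first-order condition
  with the difference quotient \<open>E t v\<close> of the fixed step size \<open>t\<close> in place of the derivative.\<close>

lemma first_order:
  assumes v: "v \<in> L2 Q" and t: "t > 0" and J: "J > 0" and feas: "(\<lambda>z. u_bar z + t * v z) \<in> U"
  shows "0 \<le> L2_inner Q F1 v + \<mu> * (L2_inner B f (E t v) / J)"
proof (rule nonneg_of_affine_nonneg[OF t])
  fix x assume x: "0 < x" "x \<le> t"
  define p where "p = L2_inner B f (E t v)"
  define m where "m = L2_inner B (E t v) (E t v)"
  define n where "n = j (\<lambda>z. u_bar z + x * v z)"
  \<comment> \<open>The step \<open>x\<close> is the fraction \<open>s\<close> of the fixed step, so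
    convexity bounds its slices by means of the quotient for \<open>t\<close>.\<close>
  define s where "s = x / t"
  have s: "0 \<le> s" "s \<le> 1" "s * t = x" using x t by (auto simp: s_def)
  let ?h = "S (\<lambda>z. \<bar>u_bar z + x * v z\<bar>)"
  have vx: "(\<lambda>z. \<bar>u_bar z + x * v z\<bar>) \<in> L2 Q" by (intro L2_intros u_bar v)
  have fE: "(\<lambda>s. f s + x * E t v s) \<in> L2 B" by (intro L2_intros f_L2 E_L2 v t)
  have "AE s in B. ?h s \<le> S (\<lambda>z. \<bar>u_bar z\<bar> + x * abs_quot t (u_bar z) (v z)) s"
    by (rule slice_mono)
      (use vx abs_add_scaled_le[OF t s(1,2)] in \<open>auto simp: s(3) intro!: L2_intros u_bar quot_L2 v t\<close>)
  then have le: "AE s in B. \<bar>?h s\<bar> \<le> \<bar>f s + x * E t v s\<bar>"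
    using slice_add[OF L2_abs[OF u_bar] quot_L2[OF v t], of x]
  proof eventually_elim
    case (elim s)
    have "?h s \<ge> 0" by (simp add: slice_integral_def)
    then show ?case using elim by (simp add: f_def E_def)
  qed
  have "n\<^sup>2 = L2_inner B ?h ?h" by (simp add: n_def j_def L2_norm_power2)
  also have "\<dots> \<le> L2_inner B (\<lambda>s. f s + x * E t v s) (\<lambda>s. f s + x * E t v s)"
    by (rule L2_inner_self_mono[OF slice_in_L2(1)[OF vx] fE le])
  also have "\<dots> = J\<^sup>2 + (2 * x * p + x\<^sup>2 * m)"
    by (simp add: L2_inner_self_add_scaled f_L2 E_L2 v t L2_inner_f_f p_def m_def)
  finally have n2: "n\<^sup>2 \<le> J\<^sup>2 + (2 * x * p + x\<^sup>2 * m)" .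
  define y where "y = 2 * x * p + x\<^sup>2 * m"
  \<comment> \<open>Squares are compared below, so the tangent value \<open>J + y / (2 * J)\<close>
    has to be nonnegative.\<close>
  have "J\<^sup>2 + y \<ge> 0" using n2 zero_le_power2[of n] unfolding y_def by linarith
  then have "0 \<le> (J\<^sup>2 + y) / (2 * J) + J / 2" using J by simp
  also have "\<dots> = J + y / (2 * J)" using J by (simp add: field_simps power2_eq_square)
  finally have nn: "0 \<le> J + y / (2 * J)" .
  have "n \<le> J + y / (2 * J)"
  proof (rule power2_le_imp_le[OF _ nn])
    have "(J + y / (2 * J))\<^sup>2 = J\<^sup>2 + y + (y / (2 * J))\<^sup>2"
      using J by (simp add: power2_sum)
    moreover have "n\<^sup>2 \<le> J\<^sup>2 + y" using n2 by (simp add: y_def)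
    ultimately show "n\<^sup>2 \<le> (J + y / (2 * J))\<^sup>2" using zero_le_power2[of "y / (2 * J)"] by linarith
  qed
  then have "\<mu> * n \<le> \<mu> * (J + y / (2 * J))" using \<mu> by (intro mult_left_mono) auto
  moreover have "\<mu> * J \<le> \<mu> * n + x * L2_inner Q F1 v"
    unfolding n_def using subgradient_step[OF v x(1)] U_convex[OF v feas s(1,2)] s(3) by simp
  ultimately have "0 \<le> \<mu> * (y / (2 * J)) + x * L2_inner Q F1 v"
    by (simp add: distrib_left)
  also have "\<dots> = x * (L2_inner Q F1 v + \<mu> * (p / J) + x * (\<mu> * m / (2 * J)))"
    using J by (simp add: y_def field_simps power2_eq_square)
  finally show "0 \<le> L2_inner Q F1 v + \<mu> * (L2_inner B f (E t v) / J) + x * (\<mu> * m / (2 * J))"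
    using x(1) by (simp add: zero_le_mult_iff p_def)
qed

section \<open>Strong limits of derivatives and difference quotients\<close>

lemma D_strong_conv:
  assumes vs: "L2_strong_conv Q vs v"
  shows "L2_strong_conv B (\<lambda>k. D (vs k)) (D v)"
  unfolding D_def
proof (rule slice_strong_conv)
  note [simp] = L2_strong_convD(1,2)[OF vs]
  have "L2_norm Q (\<lambda>z. abs_deriv (u_bar z) (vs k z) - abs_deriv (u_bar z) (v z))
      \<le> L2_norm Q (\<lambda>z. vs k z - v z)" for k
    unfolding L2_norm_inner
    by (intro real_sqrt_le_mono L2_inner_self_mono L2_diff deriv_L2) (auto simp: abs_deriv_lipschitz)
  then have "(\<lambda>k. L2_norm Q (\<lambda>z. abs_deriv (u_bar z) (vs k z) - abs_deriv (u_bar z) (v z))) \<longlonglongrightarrow> 0"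
    by (intro Lim_null_comparison[OF _ L2_strong_convD(3)[OF vs]])
      (auto intro!: always_eventually simp: L2_norm_nonneg)
  then show "L2_strong_conv Q (\<lambda>k z. abs_deriv (u_bar z) (vs k z)) (\<lambda>z. abs_deriv (u_bar z) (v z))"
    by (simp add: L2_strong_conv_def deriv_L2)
qed

lemma dj_strong_conv:
  assumes "L2_strong_conv Q vs v"
  shows "(\<lambda>k. dj (vs k)) \<longlonglongrightarrow> dj v"
proof -
  note D = D_strong_conv[OF assms]
  have "(\<lambda>k. L2_norm B (D (vs k))) \<longlonglongrightarrow> L2_norm B (D v)"
    unfolding L2_norm_inner by (intro tendsto_real_sqrt L2_strong_imp_inner_self D)
  moreover have "(\<lambda>k. L2_inner B f (D (vs k)) / J) \<longlonglongrightarrow> L2_inner B f (D v) / J"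
    unfolding divide_inverse L2_inner_commute[of B f]
    by (intro tendsto_mult tendsto_const L2_strong_imp_inner[OF D f_L2])
  ultimately show ?thesis by (simp add: dj_def)
qed

text \<open>For a fixed direction the quotients are dominated by \<open>v\<close> and at each point
  eventually equal to the derivative.\<close>

lemma E_strong_conv:
  assumes v: "v \<in> L2 Q" and t: "\<And>k. t k > 0" "t \<longlonglongrightarrow> 0"
  shows "L2_strong_conv B (\<lambda>k. E (t k) v) (D v)"
  unfolding D_def E_def
  by (rule slice_strong_conv, rule L2_dominated_convergence[OF v deriv_L2[OF v]])
    (use v t in \<open>auto simp: abs_abs_quot_le abs_quot_tendsto\<close>)

text \<open>The identity \<open>n - (J + t p) = (n\<^sup>2 - (J + t p)\<^sup>2) / (n + J + t p)\<close> turns the expansion of \<open>n\<^sup>2\<close>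
  into one of \<open>n\<close>.\<close>

lemma j_second_order:
  assumes v: "v \<in> L2 Q" and t: "t > 0" and J: "J > 0"
  defines "p \<equiv> L2_inner B f (E t v) / J" and "n \<equiv> j (\<lambda>z. u_bar z + t * v z)"
  shows "(n - J - t * p) * (n + J + t * p) = t\<^sup>2 * (L2_inner B (E t v) (E t v) - p\<^sup>2)"
proof -
  have "n\<^sup>2 = J\<^sup>2 + 2 * t * (J * p) + t\<^sup>2 * L2_inner B (E t v) (E t v)"
    using j_expand[OF v t] J by (simp add: n_def p_def)
  then show ?thesis by (simp add: algebra_simps power2_eq_square)
qed

lemma j_directional_limit:
  assumes v: "v \<in> L2 Q" and t: "\<And>k. t k > 0" "t \<longlonglongrightarrow> 0"
  shows "(\<lambda>k. (j (\<lambda>z. u_bar z + t k * v z) - J) / t k) \<longlonglongrightarrow> dj v"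
proof -
  note E = E_strong_conv[OF v t]
  have m: "(\<lambda>k. L2_inner B (E (t k) v) (E (t k) v)) \<longlonglongrightarrow> L2_inner B (D v) (D v)"
    by (rule L2_strong_imp_inner_self[OF E])
  have p: "(\<lambda>k. L2_inner B f (E (t k) v)) \<longlonglongrightarrow> L2_inner B f (D v)"
    using L2_strong_imp_inner[OF E f_L2] by (simp add: L2_inner_commute)
  show ?thesis
  proof (cases "J = 0")
    case True
    have "(\<lambda>k. L2_norm B (E (t k) v)) \<longlonglongrightarrow> L2_norm B (D v)"
      unfolding L2_norm_inner by (intro tendsto_real_sqrt m)
    then show ?thesis
      using t(1) by (simp add: True j_zero[OF v t(1) True] dj_def less_imp_neq[OF t(1), symmetric])
  next
    case False
    then have J: "J > 0" using J_nonneg by simp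
    let ?n = "\<lambda>k. j (\<lambda>z. u_bar z + t k * v z)"
    let ?p = "\<lambda>k. L2_inner B f (E (t k) v)" and ?m = "\<lambda>k. L2_inner B (E (t k) v) (E (t k) v)"
    have n: "?n k = sqrt (J\<^sup>2 + 2 * t k * ?p k + (t k)\<^sup>2 * ?m k)" for k
      by (simp add: j_expand[OF v t(1), symmetric] j_nonneg)
    have "?n \<longlonglongrightarrow> sqrt (J\<^sup>2 + 2 * 0 * L2_inner B f (D v) + 0\<^sup>2 * L2_inner B (D v) (D v))"
      unfolding n by (intro tendsto_intros t p m)
    then have n_lim: "?n \<longlonglongrightarrow> J" using J by simp
    \<comment> \<open>Multiplication by the conjugate \<open>?n k + J\<close> removes the square
      root.\<close>
    have eq: "(?n k - J) / t k = (2 * ?p k + t k * ?m k) / (?n k + J)" for k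
    proof -
      have "(?n k - J) * (?n k + J) = t k * (2 * ?p k + t k * ?m k)"
        using j_expand[OF v t(1)[of k]] by (simp add: algebra_simps power2_eq_square)
      moreover have "?n k + J > 0" using J j_nonneg by (simp add: add_nonneg_pos)
      ultimately show ?thesis using t(1)[of k] by (simp add: frac_eq_eq mult.commute)
    qed
    have "(\<lambda>k. (2 * ?p k + t k * ?m k) / (?n k + J))
        \<longlonglongrightarrow> (2 * L2_inner B f (D v) + 0 * L2_inner B (D v) (D v)) / (J + J)"
      using J by (intro tendsto_intros p m t n_lim) auto
    then show ?thesis using J unfolding eq by (simp add: dj_def)
  qed
qed

lemma dir_deriv_j: "v \<in> L2 Q \<Longrightarrow> dir_deriv j u_bar v = dj v"
  unfolding dir_deriv_def
  by (intro tendsto_Lim) (auto simp: tendsto_at_iff_sequentially comp_def J_def[symmetric]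
      intro!: j_directional_limit)

text \<open>Where the slice of \<open>u_bar\<close> vanishes, \<open>abs_deriv\<close> is an
  absolute value. The slice must be integrable, since otherwise \<open>f t = 0\<close> could be a
  default value.\<close>

lemma f_zero_imp_D_nonneg:
  assumes v: "v \<in> L2 Q"
  shows "AE t in B. f t = 0 \<longrightarrow> D v t \<ge> 0"
  using slice_integrable[OF L2_abs[OF u_bar]] slice_integrable[OF deriv_L2[OF v]]
proof eventually_elim
  case (elim t)
  show ?case
  proof
    assume "f t = 0"
    then have "AE x in A. u_bar (x, t) = 0"
      using integral_nonneg_eq_0_iff_AE[OF elim(1)] by (simp add: f_def slice_integral_def)
    then have "AE x in A. abs_deriv (u_bar (x, t)) (v (x, t)) \<ge> 0"
      by eventually_elim (simp add: abs_deriv_def)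
    then show "D v t \<ge> 0" by (simp add: D_def slice_integral_def integral_nonneg_AE)
  qed
qed

lemma J_zero_iff: "J = 0 \<longleftrightarrow> (AE t in B. f t = 0)"
proof -
  have "J = 0 \<longleftrightarrow> (\<integral>t. (f t)\<^sup>2 \<partial>B) = 0" by (simp add: J_eq L2_norm_def)
  also have "\<dots> \<longleftrightarrow> (AE t in B. f t = 0)"
    by (subst integral_nonneg_eq_0_iff_AE[OF L2_integrable_square[OF f_L2]]) auto
  finally show ?thesis .
qed

text \<open>Its contrapositive turns a nonzero \<open>u_bar\<close> into \<open>J > 0\<close>: by
  Fubini the L1 norm on \<open>Q\<close> is the integral of \<open>f\<close>.\<close>

lemma J_zero_imp:
  assumes "J = 0" shows "AE z in Q. u_bar z = 0"
proof -
  have i: "integrable Q (\<lambda>z. \<bar>u_bar z\<bar>)" by (intro Q.L2_integrable L2_abs u_bar)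
  have "integral\<^sup>L Q (\<lambda>z. \<bar>u_bar z\<bar>) = (\<integral>t. f t \<partial>B)"
    using integral_snd[of "\<lambda>x t. \<bar>u_bar (x, t)\<bar>"] i
    by (simp add: f_def slice_integral_def case_prod_beta')
  also have "\<dots> = 0" using assms J_zero_iff f_L2 by (intro integral_eq_zero_AE) auto
  finally show ?thesis using integral_nonneg_eq_0_iff_AE[OF i] by simp
qed

end

subsection \<open>Truncated directions and test functions\<close>

context sparse_box_problem
begin

lemma trunc_cases: "trunc t v z = v z \<or> trunc t v z = 0"
  by (simp add: trunc_def)

lemma trunc_L2:
  assumes v: "v \<in> L2 Q" shows "trunc t v \<in> L2 Q"
proof (rule L2_bound[OF v])
  have [measurable]: "v \<in> borel_measurable Q" using v by simp
  show "trunc t v \<in> borel_measurable Q" unfolding trunc_def[abs_def] by measurable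
qed (simp add: trunc_def)

lemma trunc_U:
  assumes v: "v \<in> L2 Q" shows "(\<lambda>z. u_bar z + t * trunc t v z) \<in> U"
proof -
  have "AE z in Q. \<alpha> \<le> u_bar z + t * trunc t v z \<and> u_bar z + t * trunc t v z \<le> \<beta>"
    using u_bar_box by eventually_elim (simp add: trunc_def)
  then show ?thesis using L2_add[OF u_bar L2_scale[OF trunc_L2[OF v]]] by (simp add: U_def)
qed

text \<open>Serves both halves of the splitting of \<open>v\<close>: the sign conditions hold for
  \<open>v\<close> and trivially for 0.\<close>

lemma Tan_selection:
  assumes v: "v \<in> Tan" and w: "w \<in> L2 Q" "\<And>z. w z = v z \<or> w z = 0"
  shows "w \<in> Tan"
proof -
  have "AE z in Q. (u_bar z = \<alpha> \<longrightarrow> v z \<ge> 0) \<and> (u_bar z = \<beta> \<longrightarrow> v z \<le> 0)"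
    using v by (simp add: Tan_def)
  then have "AE z in Q. (u_bar z = \<alpha> \<longrightarrow> w z \<ge> 0) \<and> (u_bar z = \<beta> \<longrightarrow> w z \<le> 0)"
    by eventually_elim (metis w(2) order_refl)
  then show ?thesis using w(1) by (simp add: Tan_def)
qed

lemma trunc_Tan: "v \<in> Tan \<Longrightarrow> trunc t v \<in> Tan"
  by (rule Tan_selection[OF _ trunc_L2[OF Tan_L2] trunc_cases])

lemma trunc_diff_Tan: "v \<in> Tan \<Longrightarrow> (\<lambda>z. v z - trunc t v z) \<in> Tan"
  by (rule Tan_selection[OF _ L2_diff[OF Tan_L2 trunc_L2[OF Tan_L2]]]) (auto simp: trunc_def)

lemma E_trunc:
  assumes "t > 0" shows "E t (trunc t v) = D (trunc t v)"
proof -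
  have "abs_quot t (u_bar z) (trunc t v z) = abs_deriv (u_bar z) (trunc t v z)" for z
    by (rule abs_quot_exact[OF assms]) (simp add: trunc_def)
  then show ?thesis by (simp add: E_def D_def)
qed

text \<open>Pointwise, \<open>trunc\<close> eventually equals \<open>v\<close>: where
  \<open>u_bar\<close> lies on a bound, tangency keeps the step inside that bound; everywhere else a
  small step violates no clause.\<close>

lemma trunc_strong_conv:
  assumes v: "v \<in> Tan" and t: "\<And>k. t k > 0" "t \<longlonglongrightarrow> 0"
  shows "L2_strong_conv Q (\<lambda>k. trunc (t k) v) v"
proof (rule L2_dominated_convergence)
  have vL: "v \<in> L2 Q" using v by (rule Tan_L2)
  \<comment> \<open>Two goals, as \<open>v\<close> is both the majorant and the limit.\<close>
  show "v \<in> L2 Q" "v \<in> L2 Q" by fact+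
  show "trunc (t k) v \<in> borel_measurable Q" for k using trunc_L2[OF vL] by simp
  show "AE z in Q. \<bar>trunc (t k) v z\<bar> \<le> \<bar>v z\<bar>" for k by (simp add: trunc_def)
  have "AE z in Q. (u_bar z = \<alpha> \<longrightarrow> v z \<ge> 0) \<and> (u_bar z = \<beta> \<longrightarrow> v z \<le> 0)"
    using v by (simp add: Tan_def)
  then show "AE z in Q. (\<lambda>k. trunc (t k) v z) \<longlonglongrightarrow> v z"
    using u_bar_box
  proof eventually_elim
    case (elim z)
    have lim: "(\<lambda>k. u_bar z + t k * v z) \<longlonglongrightarrow> u_bar z"
      using tendsto_add[OF tendsto_const tendsto_mult_left_zero[OF t(2)], of "u_bar z" "v z"] by simp
    have "\<forall>\<^sub>F k in sequentially. \<alpha> \<le> u_bar z + t k * v z"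
    proof (cases "u_bar z = \<alpha>")
      case True
      then show ?thesis using elim t(1) by (simp add: less_imp_le)
    next
      case False
      then have "\<alpha> < u_bar z" using elim by simp
      from order_tendstoD(1)[OF lim this] show ?thesis by eventually_elim simp
    qed
    moreover have "\<forall>\<^sub>F k in sequentially. u_bar z + t k * v z \<le> \<beta>"
    proof (cases "u_bar z = \<beta>")
      case True
      then show ?thesis using elim t(1) by (simp add: less_imp_le mult_nonneg_nonpos)
    next
      case False
      then have "u_bar z < \<beta>" using elim by simp
      from order_tendstoD(2)[OF lim this] show ?thesis by eventually_elim simp
    qed
    moreover have "\<forall>\<^sub>F k in sequentially. u_bar z = 0 \<or> \<bar>t k * v z\<bar> \<le> \<bar>u_bar z\<bar>"
      using eventually_small_multiple[OF t(2), of "u_bar z" "v z"] by (cases "u_bar z = 0") auto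
    ultimately have "\<forall>\<^sub>F k in sequentially. trunc (t k) v z = v z"
      by eventually_elim (simp add: trunc_def)
    then show ?case by (rule tendsto_eventually)
  qed
qed

text \<open>The truncated step is feasible and satisfies \<open>E = D\<close>, so the subgradient
  inequality itself (\<open>J = 0\<close>) or \<open>first_order\<close> (\<open>J > 0\<close>)
  already speaks of the derivative.\<close>

lemma tangent_nonneg_trunc:
  assumes v: "v \<in> L2 Q" and t: "t > 0"
  shows "0 \<le> L2_inner Q F1 (trunc t v) + \<mu> * dj (trunc t v)"
proof (cases "J = 0")
  case True
  have "0 \<le> t * (\<mu> * dj (trunc t v) + L2_inner Q F1 (trunc t v))"
    using subgradient_step[OF trunc_L2[OF v] t trunc_U[OF v]] True
      j_zero[OF trunc_L2[OF v] t True] E_trunc[OF t] by (simp add: dj_def algebra_simps)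
  then show ?thesis using t by (simp add: zero_le_mult_iff add.commute)
next
  case False
  then show ?thesis
    using first_order[OF trunc_L2[OF v] t _ trunc_U[OF v]] J_nonneg E_trunc[OF t] by (simp add: dj_def)
qed

lemma null_seq_inverse: "(\<lambda>k. 1 / real (Suc k)) \<longlonglongrightarrow> 0"
  by (rule LIMSEQ_Suc[OF lim_1_over_n[where 'a = real]])

text \<open>Tangent directions are strong limits of truncated ones, and the first-order expression
  is continuous along such limits.\<close>

lemma tangent_nonneg:
  assumes v: "v \<in> Tan"
  shows "0 \<le> L2_inner Q F1 v + \<mu> * dj v"
proof (rule LIMSEQ_le_const)
  note conv = trunc_strong_conv[OF v _ null_seq_inverse]
  show "(\<lambda>k. L2_inner Q F1 (trunc (1 / real (Suc k)) v) + \<mu> * dj (trunc (1 / real (Suc k)) v))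
      \<longlonglongrightarrow> L2_inner Q F1 v + \<mu> * dj v"
    unfolding L2_inner_commute[of Q F1]
    by (intro tendsto_intros L2_strong_imp_inner dj_strong_conv conv F1) auto
  show "\<exists>N. \<forall>n\<ge>N. 0 \<le> L2_inner Q F1 (trunc (1 / real (Suc n)) v) + \<mu> * dj (trunc (1 / real (Suc n)) v)"
    using tangent_nonneg_trunc[OF Tan_L2[OF v]] by auto
qed

text \<open>\<open>D\<close> is additive along the splitting of \<open>v\<close> into its truncation and the remainder, and the
  first-order expression is nonnegative on both parts, so criticality of \<open>v\<close> passes to the truncation.\<close>

lemma trunc_critical:
  assumes v: "v \<in> Tan" and crit: "L2_inner Q F1 v + \<mu> * dj v = 0" and J: "J > 0" and t: "t > 0"
  shows "L2_inner Q F1 (trunc t v) + \<mu> * dj (trunc t v) = 0"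
proof -
  let ?w = "trunc t v" and ?r = "\<lambda>z. v z - trunc t v z"
  have L: "v \<in> L2 Q" "?w \<in> L2 Q" "?r \<in> L2 Q" by (intro L2_diff trunc_L2 Tan_L2 v)+
  have [measurable]: "D v \<in> borel_measurable B" "D ?w \<in> borel_measurable B" "D ?r \<in> borel_measurable B"
    "f \<in> borel_measurable B"
    using L D_L2 f_L2 by auto
  have "(\<lambda>z. abs_deriv (u_bar z) (v z))
      = (\<lambda>z. abs_deriv (u_bar z) (?w z) + 1 * abs_deriv (u_bar z) (?r z))"
  proof
    fix z
    show "abs_deriv (u_bar z) (v z) = abs_deriv (u_bar z) (?w z) + 1 * abs_deriv (u_bar z) (?r z)"
      using trunc_cases[of t v z] by (auto simp: abs_deriv_def)
  qed
  then have "AE s in B. D v s = D ?w s + D ?r s"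
    using slice_add[OF deriv_L2[OF L(2)] deriv_L2[OF L(3)], of 1] by (simp add: D_def)
  then have "L2_inner B (D v) f = L2_inner B (\<lambda>s. D ?w s + D ?r s) f"
    by (rule L2_inner_cong_AE) measurable
  also have "\<dots> = L2_inner B (D ?w) f + L2_inner B (D ?r) f"
    by (intro L2_inner_add_left D_L2 L f_L2)
  finally have "L2_inner B f (D v) = L2_inner B f (D ?w) + L2_inner B f (D ?r)"
    by (simp only: L2_inner_commute[of B f])
  then have dj: "dj v = dj ?w + dj ?r" using J by (simp add: dj_def add_divide_distrib)
  have "L2_inner Q F1 v = L2_inner Q F1 ?w + L2_inner Q F1 ?r"
    using L2_inner_add_right[OF L(2,3) F1] by simp
  then have "0 = (L2_inner Q F1 ?w + \<mu> * dj ?w) + (L2_inner Q F1 ?r + \<mu> * dj ?r)"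
    using crit dj by (simp add: algebra_simps)
  then show ?thesis
    using tangent_nonneg[OF trunc_Tan[OF v, of t]] tangent_nonneg[OF trunc_diff_Tan[OF v, of t]] by linarith
qed

section \<open>Second-order quotients along truncated directions\<close>

definition quotient :: "real \<Rightarrow> ('a \<times> 'b \<Rightarrow> real) \<Rightarrow> real" where
  "quotient t v = (\<mu> * j (\<lambda>z. u_bar z + t * v z) - \<mu> * J + t * L2_inner Q F1 v) / (t\<^sup>2 / 2)"

text \<open>For \<open>J > 0\<close>, this is \<open>\<mu>\<close> times the second derivative of
  the Hilbert norm at \<open>f\<close> in direction \<open>D v\<close>.\<close>

definition curvature :: "('a \<times> 'b \<Rightarrow> real) \<Rightarrow> real" where
  "curvature v = \<mu> / J * (L2_inner B (D v) (D v) - (dj v)\<^sup>2)"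

lemma recovery_quotient:
  assumes v: "v \<in> Tan" and crit: "L2_inner Q F1 v + \<mu> * dj v = 0" and J: "J > 0"
    and t: "\<And>k. t k > 0" "t \<longlonglongrightarrow> 0"
  shows "(\<lambda>k. quotient (t k) (trunc (t k) v)) \<longlonglongrightarrow> curvature v"
proof -
  let ?w = "\<lambda>k. trunc (t k) v"
  have wL: "?w k \<in> L2 Q" for k by (intro trunc_L2 Tan_L2 v)
  note conv = trunc_strong_conv[OF v t]
  define n where "n k = j (\<lambda>z. u_bar z + t k * ?w k z)" for k
  define p where "p k = dj (?w k)" for k
  define m where "m k = L2_inner B (D (?w k)) (D (?w k))" for k
  have p: "p \<longlonglongrightarrow> dj v" unfolding p_def by (rule dj_strong_conv[OF conv])
  have m: "m \<longlonglongrightarrow> L2_inner B (D v) (D v)"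
    unfolding m_def by (rule L2_strong_imp_inner_self[OF D_strong_conv[OF conv]])
  have "(n k)\<^sup>2 = J\<^sup>2 + 2 * t k * (J * p k) + (t k)\<^sup>2 * m k" for k
    using j_expand[OF wL[of k] t(1)[of k]] J
    by (simp add: E_trunc[OF t(1)] dj_def n_def p_def m_def)
  then have n: "n k = sqrt (J\<^sup>2 + 2 * t k * (J * p k) + (t k)\<^sup>2 * m k)" for k
    using j_nonneg by (metis n_def real_sqrt_unique)
  have "n \<longlonglongrightarrow> sqrt (J\<^sup>2 + 2 * 0 * (J * dj v) + 0\<^sup>2 * L2_inner B (D v) (D v))"
    unfolding n by (intro tendsto_intros t p m)
  then have n_lim: "n \<longlonglongrightarrow> J" using J by simp
  \<comment> \<open>The conjugate factor from \<open>j_second_order\<close>; its limit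
    \<open>2 * J\<close> produces the factor \<open>\<mu> / J\<close>.\<close>
  define W where "W k = n k + J + t k * p k" for k
  have "W \<longlonglongrightarrow> J + J + 0 * dj v"
    unfolding W_def by (intro tendsto_intros n_lim t p)
  then have W: "W \<longlonglongrightarrow> 2 * J" by simp
  have "(\<lambda>k. 2 * \<mu> * (m k - (p k)\<^sup>2) / W k)
      \<longlonglongrightarrow> 2 * \<mu> * (L2_inner B (D v) (D v) - (dj v)\<^sup>2) / (2 * J)"
    using J by (intro tendsto_intros m p W) auto
  also have "2 * \<mu> * (L2_inner B (D v) (D v) - (dj v)\<^sup>2) / (2 * J) = curvature v"
    by (simp add: curvature_def)
  finally show ?thesis
  proof (rule Lim_transform_eventually)
    have "\<forall>\<^sub>F k in sequentially. W k > 0"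
      using order_tendstoD(1)[OF W, of 0] J by simp
    then show "\<forall>\<^sub>F k in sequentially. 2 * \<mu> * (m k - (p k)\<^sup>2) / W k = quotient (t k) (?w k)"
    proof eventually_elim
      case (elim k)
      have "(n k - J - t k * p k) * W k = (t k)\<^sup>2 * (m k - (p k)\<^sup>2)"
        using j_second_order[OF wL[of k] t(1)[of k] J] J
        by (simp add: E_trunc[OF t(1)] dj_def n_def p_def m_def W_def)
      then have "(m k - (p k)\<^sup>2) / W k = (n k - J - t k * p k) / (t k)\<^sup>2"
        using elim t(1)[of k] by (simp add: frac_eq_eq mult.commute)
      then have "2 * \<mu> * (m k - (p k)\<^sup>2) / W k = 2 * \<mu> * ((n k - J - t k * p k) / (t k)\<^sup>2)"
        by (metis times_divide_eq_right)
      also have "\<dots> = (\<mu> * n k - \<mu> * J + t k * (- (\<mu> * p k))) / ((t k)\<^sup>2 / 2)"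
        by (simp add: algebra_simps)
      \<comment> \<open>Exact criticality of the truncated direction: no first-order remainder is
        left to be divided by the square of \<open>t k\<close>.\<close>
      also have "- (\<mu> * p k) = L2_inner Q F1 (?w k)"
        using trunc_critical[OF v crit J t(1)[of k]] by (simp add: p_def)
      finally show ?case by (simp add: quotient_def n_def)
    qed
  qed
qed

text \<open>Since \<open>\<bar>a + t c\<bar> - \<bar>a\<bar> \<ge> t c \<sigma>\<close> with \<open>\<sigma> = dir_sign a b\<close> independent of \<open>c\<close>, the difference quotients
  along a weakly convergent sequence are bounded below by a functional which is linear in the sequence.\<close>

definition test_fun :: "('a \<times> 'b \<Rightarrow> real) \<Rightarrow> ('b \<Rightarrow> real) \<Rightarrow> 'a \<times> 'b \<Rightarrow> real" where
  "test_fun v p z = p (snd z) * dir_sign (u_bar z) (v z)"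

lemma test_fun_L2:
  assumes v: "v \<in> L2 Q" and p: "p \<in> L2 B"
  shows "test_fun v p \<in> L2 Q"
proof (rule L2_bound[OF L2_snd[OF p]])
  have [measurable]: "v \<in> borel_measurable Q" "p \<in> borel_measurable B" using v p by auto
  show "test_fun v p \<in> borel_measurable Q" unfolding test_fun_def[abs_def] by measurable
  show "AE z in Q. \<bar>test_fun v p z\<bar> \<le> \<bar>p (snd z)\<bar>"
    by (simp add: test_fun_def abs_mult mult_left_le abs_dir_sign_le)
qed

text \<open>The pointwise subgradient inequality is multiplied by \<open>p\<close> and integrated,
  hence the sign condition on \<open>p\<close>.\<close>

lemma test_fun_le_E:
  assumes v: "v \<in> L2 Q" and w: "w \<in> L2 Q" and p: "p \<in> L2 B" "AE s in B. p s \<ge> 0" and t: "t > 0"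
  shows "L2_inner Q w (test_fun v p) \<le> L2_inner B (E t w) p"
proof -
  have "AE z in Q. p (snd z) \<ge> 0"
  proof -
    have [measurable]: "p \<in> borel_measurable B" using p by simp
    have "AE x in A. AE s in B. p (snd (x, s)) \<ge> 0" using p(2) by simp
    then show ?thesis by (intro AE_pair_measure) auto
  qed
  then have "AE z in Q. w z * test_fun v p z \<le> abs_quot t (u_bar z) (w z) * p (snd z)"
  proof eventually_elim
    case (elim z)
    from mult_right_mono[OF dir_sign_le_abs_quot[OF t, of "w z" "u_bar z" "v z"] elim]
    show ?case by (simp add: test_fun_def mult.commute mult.left_commute)
  qed
  then have "L2_inner Q w (test_fun v p) \<le> L2_inner Q (\<lambda>z. abs_quot t (u_bar z) (w z)) (\<lambda>z. p (snd z))"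
    unfolding L2_inner_def
    by (intro integral_mono_AE L2_mult_integrable w test_fun_L2 v p quot_L2 t L2_snd)
  then show ?thesis
    unfolding E_def by (simp add: L2_inner_slice p quot_L2 w t)
qed

text \<open>At \<open>w = v\<close> the linear lower bound is a pairing with the derivative, so weak
  limits of the lower bounds are pairings with \<open>D v\<close>.\<close>

lemma test_fun_D:
  assumes v: "v \<in> L2 Q" and p: "p \<in> L2 B"
  shows "L2_inner Q v (test_fun v p) = L2_inner B (D v) p"
  unfolding D_def L2_inner_slice[OF p deriv_L2[OF v]]
  by (simp add: L2_inner_def test_fun_def abs_deriv_dir_sign mult.commute mult.left_commute)

lemma Tan_weakly_closed:
  assumes vs: "L2_weak_conv Q vs v" and Tan: "\<And>k. vs k \<in> Tan"
  shows "v \<in> Tan"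
proof -
  have vL: "v \<in> L2 Q" and vsL: "\<And>k. vs k \<in> L2 Q"
    and lim: "\<And>g. g \<in> L2 Q \<Longrightarrow> (\<lambda>k. L2_inner Q (vs k) g) \<longlonglongrightarrow> L2_inner Q v g"
    using vs by (auto simp: L2_weak_conv_def)
  have [measurable]: "v \<in> borel_measurable Q" using vL by simp
  have key: "AE z in Q. u_bar z = c \<longrightarrow> s * v z \<ge> 0"
    if c: "\<And>k. AE z in Q. u_bar z = c \<longrightarrow> s * vs k z \<ge> 0" for c s :: real
  proof -
    \<comment> \<open>Supported where \<open>v\<close> breaks the sign condition:
      \<open>v * ?g\<close> is nonpositive pointwise, while weak convergence makes its integral
      nonnegative.\<close>
    let ?g = "\<lambda>z. if u_bar z = c \<and> s * v z < 0 then s else 0"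
    have "(\<lambda>x. s) \<in> L2 Q" by (simp add: L2_def)
    then have g: "?g \<in> L2 Q" by (rule L2_bound) auto
    have "0 \<le> L2_inner Q (vs k) ?g" for k
    proof -
      have "AE z in Q. 0 \<le> vs k z * ?g z"
        using c[of k] by eventually_elim (auto simp: mult.commute)
      then show ?thesis unfolding L2_inner_def by (rule integral_nonneg_AE)
    qed
    then have "0 \<le> L2_inner Q v ?g"
      by (intro LIMSEQ_le_const[OF lim[OF g]]) auto
    moreover have neg: "0 \<le> - (v z * ?g z)" for z by (auto simp: mult.commute)
    moreover have "0 \<le> integral\<^sup>L Q (\<lambda>z. - (v z * ?g z))" by (rule integral_nonneg_AE[OF AE_I2[OF neg]])
    ultimately have z: "integral\<^sup>L Q (\<lambda>z. - (v z * ?g z)) = 0" by (simp add: L2_inner_def)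
    have i: "integrable Q (\<lambda>z. - (v z * ?g z))"
      by (intro Bochner_Integration.integrable_minus L2_mult_integrable vL g)
    have "AE z in Q. - (v z * ?g z) = 0"
      using integral_nonneg_eq_0_iff_AE[OF i AE_I2[OF neg]] z by simp
    then show ?thesis
    proof eventually_elim
      case (elim z)
      then show ?case by (cases "s * v z < 0") (auto simp: mult.commute)
    qed
  qed
  have "AE z in Q. u_bar z = \<alpha> \<longrightarrow> 1 * v z \<ge> 0"
    by (rule key) (use Tan in \<open>auto simp: Tan_def elim!: eventually_mono\<close>)
  moreover have "AE z in Q. u_bar z = \<beta> \<longrightarrow> (-1) * v z \<ge> 0"
    by (rule key) (use Tan in \<open>auto simp: Tan_def elim!: eventually_mono\<close>)
  ultimately have "AE z in Q. (u_bar z = \<alpha> \<longrightarrow> v z \<ge> 0) \<and> (u_bar z = \<beta> \<longrightarrow> v z \<le> 0)"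
    by eventually_elim auto
  then show ?thesis using vL by (simp add: Tan_def)
qed

lemma feasible_imp_Tan:
  assumes v: "v \<in> L2 Q" and t: "t > 0" and U: "(\<lambda>z. u_bar z + t * v z) \<in> U"
  shows "v \<in> Tan"
proof -
  have "AE z in Q. \<alpha> \<le> u_bar z + t * v z \<and> u_bar z + t * v z \<le> \<beta>" using U by (simp add: U_def)
  then have "AE z in Q. (u_bar z = \<alpha> \<longrightarrow> v z \<ge> 0) \<and> (u_bar z = \<beta> \<longrightarrow> v z \<le> 0)"
    by eventually_elim (use t in \<open>auto simp: zero_le_mult_iff mult_le_0_iff\<close>)
  then show ?thesis using v by (simp add: Tan_def)
qed

end

subsection \<open>Second subderivative\<close>

context sparse_box_problem
begin

lemma quotient_le_iff:
  "t > 0 \<Longrightarrow> quotient t v \<le> y \<longleftrightarrow>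
    \<mu> * j (\<lambda>z. u_bar z + t * v z) - \<mu> * J + t * L2_inner Q F1 v \<le> y * (t\<^sup>2 / 2)"
  by (simp add: quotient_def pos_divide_le_eq)

lemma quotient_nonneg:
  assumes "v \<in> L2 Q" "t > 0" "(\<lambda>z. u_bar z + t * v z) \<in> U"
  shows "quotient t v \<ge> 0"
  using subgradient_step[OF assms] by (simp add: quotient_def)

text \<open>The tangent bound \<open>j_linear_lower\<close> leaves the first-order expression times
  \<open>t\<close>; dividing by \<open>t\<close>, one factor \<open>t\<close> survives on the
  right.\<close>

lemma quotient_le_slope:
  assumes v: "v \<in> L2 Q" and t: "t > 0" and J: "J > 0" and y: "quotient t v \<le> y"
  shows "L2_inner Q F1 v + \<mu> * (L2_inner B f (E t v) / J) \<le> y * t / 2"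
proof -
  define p where "p = L2_inner B f (E t v) / J"
  have "\<mu> * (J + t * p) \<le> \<mu> * j (\<lambda>z. u_bar z + t * v z)"
    using \<mu> unfolding p_def by (intro mult_left_mono j_linear_lower v t J) simp
  then have "t * (L2_inner Q F1 v + \<mu> * p) \<le> y * (t\<^sup>2 / 2)"
    using y unfolding quotient_le_iff[OF t] by (simp add: algebra_simps)
  also have "\<dots> = t * (y * t / 2)" by (simp add: power2_eq_square)
  finally show ?thesis using t by (simp add: p_def)
qed

text \<open>Bounded quotients make the first-order expression at most 0 in the limit. Replacing
  \<open>E\<close> by its linear lower bound carries this to the weak limit, where
  \<open>tangent_nonneg\<close> supplies the opposite inequality.\<close>

lemma bounded_quotients_critical:
  assumes t: "\<And>k. t k > 0" "t \<longlonglongrightarrow> 0" and vs: "L2_weak_conv Q vs v"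
    and U: "\<And>k. (\<lambda>z. u_bar z + t k * vs k z) \<in> U" and y: "\<And>k. quotient (t k) (vs k) \<le> y"
  shows "v \<in> Tan" and "L2_inner Q F1 v + \<mu> * dj v = 0"
proof -
  have vL: "v \<in> L2 Q" and vsL: "\<And>k. vs k \<in> L2 Q"
    and lim: "\<And>g. g \<in> L2 Q \<Longrightarrow> (\<lambda>k. L2_inner Q (vs k) g) \<longlonglongrightarrow> L2_inner Q v g"
    using vs by (auto simp: L2_weak_conv_def)
  show v: "v \<in> Tan"
    by (rule Tan_weakly_closed[OF vs]) (rule feasible_imp_Tan[OF vsL t(1) U])
  have F1_lim: "(\<lambda>k. L2_inner Q F1 (vs k)) \<longlonglongrightarrow> L2_inner Q F1 v"
    using lim[OF F1] by (simp only: L2_inner_commute[of Q F1])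
  have t_lim: "(\<lambda>k. y * t k / 2) \<longlonglongrightarrow> 0"
    using tendsto_mult_right_zero[OF t(2), of "y / 2"] by simp
  have "L2_inner Q F1 v + \<mu> * dj v \<le> 0"
  proof (cases "J = 0")
    case False
    then have J: "J > 0" using J_nonneg by simp
    have "L2_inner Q F1 v + \<mu> * (L2_inner Q v (test_fun v f) / J) \<le> 0"
    proof (rule LIMSEQ_le[OF _ t_lim])
      show "(\<lambda>k. L2_inner Q F1 (vs k) + \<mu> * (L2_inner Q (vs k) (test_fun v f) / J))
          \<longlonglongrightarrow> L2_inner Q F1 v + \<mu> * (L2_inner Q v (test_fun v f) / J)"
        using J by (intro tendsto_intros F1_lim lim test_fun_L2 vL f_L2) simp
      have "L2_inner Q F1 (vs k) + \<mu> * (L2_inner Q (vs k) (test_fun v f) / J) \<le> y * t k / 2" for k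
      proof -
        have "L2_inner Q (vs k) (test_fun v f) \<le> L2_inner B f (E (t k) (vs k))"
          using test_fun_le_E[OF vL vsL[of k] f_L2 _ t(1)[of k]] f_nonneg
          by (simp add: L2_inner_commute[of B f])
        then have "\<mu> * (L2_inner Q (vs k) (test_fun v f) / J)
            \<le> \<mu> * (L2_inner B f (E (t k) (vs k)) / J)"
          using J \<mu> by (intro mult_left_mono divide_right_mono) auto
        then show ?thesis using quotient_le_slope[OF vsL[of k] t(1)[of k] J y[of k]] by linarith
      qed
      then show "\<exists>N. \<forall>n\<ge>N. L2_inner Q F1 (vs n) + \<mu> * (L2_inner Q (vs n) (test_fun v f) / J)
          \<le> y * t n / 2" by blast
    qed
    then show ?thesis
      using J by (simp add: dj_def test_fun_D[OF vL f_L2] L2_inner_commute[of B f])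
  next
    case True
    let ?D = "L2_norm B (D v)"
    \<comment> \<open>Here \<open>f\<close> vanishes almost everywhere, so \<open>D v\<close> itself
      is an admissible nonnegative test function.\<close>
    have D_nonneg: "AE s in B. D v s \<ge> 0"
      using f_zero_imp_D_nonneg[OF vL] True[unfolded J_zero_iff] by eventually_elim simp
    have step: "\<mu> * L2_norm B (E (t k) (vs k)) \<le> y * t k / 2 - L2_inner Q F1 (vs k)" for k
    proof -
      have "t k * (\<mu> * L2_norm B (E (t k) (vs k))) \<le> t k * (y * t k / 2 - L2_inner Q F1 (vs k))"
        using y[of k] unfolding quotient_le_iff[OF t(1)] j_zero[OF vsL t(1) True]
        by (simp add: True algebra_simps power2_eq_square)
      then show ?thesis using t(1)[of k] by simp
    qed
    have "\<mu> * L2_inner Q v (test_fun v (D v)) \<le> ?D * (0 - L2_inner Q F1 v)"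
    proof (rule LIMSEQ_le)
      show "(\<lambda>k. \<mu> * L2_inner Q (vs k) (test_fun v (D v))) \<longlonglongrightarrow> \<mu> * L2_inner Q v (test_fun v (D v))"
        by (intro tendsto_intros lim test_fun_L2 vL D_L2)
      show "(\<lambda>k. ?D * (y * t k / 2 - L2_inner Q F1 (vs k))) \<longlonglongrightarrow> ?D * (0 - L2_inner Q F1 v)"
        by (intro tendsto_intros t_lim F1_lim)
      have "\<mu> * L2_inner Q (vs k) (test_fun v (D v)) \<le> ?D * (y * t k / 2 - L2_inner Q F1 (vs k))" for k
      proof -
        have "L2_inner Q (vs k) (test_fun v (D v)) \<le> L2_norm B (E (t k) (vs k)) * ?D"
          using test_fun_le_E[OF vL vsL[of k] D_L2[OF vL] D_nonneg t(1)[of k]]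
            abs_L2_inner_le[OF E_L2[OF vsL t(1)] D_L2[OF vL], of k k] by linarith
        then have "\<mu> * L2_inner Q (vs k) (test_fun v (D v)) \<le> \<mu> * (L2_norm B (E (t k) (vs k)) * ?D)"
          using \<mu> by (intro mult_left_mono) auto
        also have "\<dots> = ?D * (\<mu> * L2_norm B (E (t k) (vs k)))" by simp
        also have "\<dots> \<le> ?D * (y * t k / 2 - L2_inner Q F1 (vs k))"
          by (intro mult_left_mono step L2_norm_nonneg)
        finally show ?thesis .
      qed
      then show "\<exists>N. \<forall>n\<ge>N. \<mu> * L2_inner Q (vs n) (test_fun v (D v))
          \<le> ?D * (y * t n / 2 - L2_inner Q F1 (vs n))" by blast
    qed
    \<comment> \<open>Tested with \<open>D v\<close>, the lower bound is the square of its norm; one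
      factor is cancelled below.\<close>
    then have le: "?D * (L2_inner Q F1 v + \<mu> * ?D) \<le> ?D * 0"
      using L2_norm_power2[of B "D v"]
      by (simp add: test_fun_D[OF vL D_L2[OF vL]] power2_eq_square algebra_simps)
    have "L2_inner Q F1 v + \<mu> * ?D \<le> 0"
    proof (cases "?D = 0")
      case False
      then have "?D > 0" using L2_norm_nonneg[of B "D v"] by simp
      then show ?thesis using le by (simp add: mult_le_0_iff)
    next
      case D0: True
      \<comment> \<open>There is no factor to cancel; the sign of the left side of
        \<open>step\<close> gives the claim in the limit.\<close>
      have "0 \<le> 0 - L2_inner Q F1 v"
      proof (rule LIMSEQ_le_const)
        show "(\<lambda>k. y * t k / 2 - L2_inner Q F1 (vs k)) \<longlonglongrightarrow> 0 - L2_inner Q F1 v"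
          by (intro tendsto_intros t_lim F1_lim)
        have "0 \<le> \<mu> * L2_norm B (E (t k) (vs k))" for k using \<mu> by (simp add: L2_norm_nonneg)
        then show "\<exists>N. \<forall>n\<ge>N. 0 \<le> y * t n / 2 - L2_inner Q F1 (vs n)"
          using step order_trans by blast
      qed
      then show ?thesis using D0 by simp
    qed
    then show ?thesis by (simp add: dj_def True)
  qed
  then show "L2_inner Q F1 v + \<mu> * dj v = 0" using tangent_nonneg[OF v] by simp
qed

text \<open>Along the sequence, criticality only controls the pairing of \<open>E\<close> with \<open>f\<close>, and test functions have
  to be nonnegative. Adding a multiple of \<open>f\<close> makes \<open>max (D v) (- c f)\<close> admissible, and these
  functions tend to \<open>D v\<close> as \<open>c\<close> grows because \<open>D v \<ge> 0\<close> where \<open>f = 0\<close>.\<close>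

lemma max_D_strong_conv:
  assumes v: "v \<in> L2 Q"
  shows "L2_strong_conv B (\<lambda>n s. max (D v s) (- (real n * f s))) (D v)"
proof (rule L2_dominated_convergence[OF D_L2 D_L2])
  have [measurable]: "D v \<in> borel_measurable B" "f \<in> borel_measurable B"
    using v D_L2 f_L2 by auto
  show "(\<lambda>s. max (D v s) (- (real n * f s))) \<in> borel_measurable B" for n by measurable
  show "AE s in B. \<bar>max (D v s) (- (real n * f s))\<bar> \<le> \<bar>D v s\<bar>" for n
  proof (rule AE_I2)
    fix s
    have "0 \<le> real n * f s" by (simp add: f_nonneg)
    then show "\<bar>max (D v s) (- (real n * f s))\<bar> \<le> \<bar>D v s\<bar>" by (simp add: max_def)
  qed
  show "AE s in B. (\<lambda>n. max (D v s) (- (real n * f s))) \<longlonglongrightarrow> D v s"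
    using f_zero_imp_D_nonneg[OF v]
  proof eventually_elim
    case (elim s)
    show ?case
    proof (cases "f s = 0")
      case True
      then show ?thesis using elim by (simp add: max_def)
    next
      case False
      then have fs: "f s > 0" using f_nonneg[of s] by simp
      obtain N :: nat where N: "real N > - D v s / f s" using reals_Archimedean2 by blast
      have "\<forall>\<^sub>F n in sequentially. max (D v s) (- (real n * f s)) = D v s"
        using eventually_ge_at_top[of N]
      proof eventually_elim
        case (elim n)
        then have "- D v s / f s < real n" using N by linarith
        then show ?case using fs by (simp add: field_simps max_def)
      qed
      then show ?thesis by (rule tendsto_eventually)
    qed
  qed
qed (fact v)+

text \<open>The quotient bound becomes a bound for \<open>m - p\<^sup>2\<close>. Criticality makes
  \<open>p\<close> converge, and \<open>m\<close> is bounded below by duality against test functions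
  approaching \<open>D v\<close>.\<close>

lemma bounded_quotients_curvature:
  assumes t: "\<And>k. t k > 0" "t \<longlonglongrightarrow> 0" and vs: "L2_weak_conv Q vs v"
    and U: "\<And>k. (\<lambda>z. u_bar z + t k * vs k z) \<in> U" and y: "\<And>k. quotient (t k) (vs k) \<le> y"
    and J: "J > 0"
  shows "curvature v \<le> y"
proof -
  have vL: "v \<in> L2 Q" and vsL: "\<And>k. vs k \<in> L2 Q"
    and lim: "\<And>g. g \<in> L2 Q \<Longrightarrow> (\<lambda>k. L2_inner Q (vs k) g) \<longlonglongrightarrow> L2_inner Q v g"
    using vs by (auto simp: L2_weak_conv_def)
  have crit: "L2_inner Q F1 v + \<mu> * dj v = 0"
    by (rule bounded_quotients_critical(2)[OF t vs U y])
  define F where "F k = L2_inner Q F1 (vs k)" for k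
  define p where "p k = L2_inner B f (E (t k) (vs k)) / J" for k
  define m where "m k = L2_inner B (E (t k) (vs k)) (E (t k) (vs k))" for k
  define n where "n k = j (\<lambda>z. u_bar z + t k * vs k z)" for k
  have F_lim: "F \<longlonglongrightarrow> L2_inner Q F1 v"
    using lim[OF F1] unfolding F_def[abs_def] by (simp only: L2_inner_commute[of Q F1])
  have lower: "0 \<le> F k + \<mu> * p k" for k
    unfolding F_def p_def by (rule first_order[OF vsL t(1) J U])
  have upper: "F k + \<mu> * p k \<le> y * t k / 2" for k
    unfolding F_def p_def by (rule quotient_le_slope[OF vsL t(1) J y])
  have t_lim: "(\<lambda>k. y * t k / 2) \<longlonglongrightarrow> 0"
    using tendsto_mult_right_zero[OF t(2), of "y / 2"] by simp
  \<comment> \<open>The first-order expression is squeezed to 0; since \<open>F\<close> converges,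
    \<open>p\<close> must tend to the value that criticality assigns to \<open>dj v\<close>.\<close>
  have "(\<lambda>k. F k + \<mu> * p k) \<longlonglongrightarrow> 0"
    by (rule tendsto_sandwich[OF always_eventually[OF allI[OF lower]]
          always_eventually[OF allI[OF upper]] tendsto_const t_lim])
  then have "(\<lambda>k. ((F k + \<mu> * p k) - F k) / \<mu>) \<longlonglongrightarrow> (0 - L2_inner Q F1 v) / \<mu>"
    using \<mu> by (intro tendsto_intros F_lim) auto
  moreover have "(0 - L2_inner Q F1 v) / \<mu> = dj v"
    using crit \<mu> by (simp add: field_simps)
  ultimately have p_lim: "p \<longlonglongrightarrow> dj v" using \<mu> by simp
  have q: "\<mu> * n k - \<mu> * J + t k * F k \<le> y * ((t k)\<^sup>2 / 2)" for k
    using y[of k] unfolding quotient_le_iff[OF t(1)] n_def F_def .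
  have n_lim: "n \<longlonglongrightarrow> J"
  proof (rule tendsto_sandwich)
    show "\<forall>\<^sub>F k in sequentially. J + t k * p k \<le> n k"
      unfolding p_def n_def by (intro always_eventually allI j_linear_lower[OF vsL t(1) J])
    have "n k \<le> J + (y * ((t k)\<^sup>2 / 2) - t k * F k) / \<mu>" for k
      using q[of k] \<mu> by (simp add: field_simps)
    then show "\<forall>\<^sub>F k in sequentially. n k \<le> J + (y * ((t k)\<^sup>2 / 2) - t k * F k) / \<mu>" by simp
    have "(\<lambda>k. J + t k * p k) \<longlonglongrightarrow> J + 0 * dj v" by (intro tendsto_intros t p_lim)
    then show "(\<lambda>k. J + t k * p k) \<longlonglongrightarrow> J" by simp
    have "(\<lambda>k. J + (y * ((t k)\<^sup>2 / 2) - t k * F k) / \<mu>)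
        \<longlonglongrightarrow> J + (y * (0\<^sup>2 / 2) - 0 * L2_inner Q F1 v) / \<mu>"
      using \<mu> by (intro tendsto_intros t F_lim) auto
    then show "(\<lambda>k. J + (y * ((t k)\<^sup>2 / 2) - t k * F k) / \<mu>) \<longlonglongrightarrow> J" by simp
  qed
  define W where "W k = n k + J + t k * p k" for k
  have "W \<longlonglongrightarrow> J + J + 0 * dj v"
    unfolding W_def by (intro tendsto_intros n_lim t p_lim)
  then have W_lim: "W \<longlonglongrightarrow> J + J" by simp
  \<comment> \<open>From \<open>j_second_order\<close>; the linear term is dropped by
    \<open>lower\<close>, so no rate for its decay is required.\<close>
  have W: "\<forall>\<^sub>F k in sequentially. \<mu> * (m k - (p k)\<^sup>2) \<le> y * W k / 2"
  proof -
    have "\<forall>\<^sub>F k in sequentially. W k > 0"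
      using order_tendstoD(1)[OF W_lim, of 0] J by simp
    then show ?thesis
    proof eventually_elim
      case (elim k)
      have "\<mu> * (n k - J - t k * p k) \<le> y * (t k)\<^sup>2 / 2"
        using q[of k] mult_left_mono[OF lower[of k] less_imp_le[OF t(1)[of k]]]
        by (simp add: algebra_simps)
      then have "\<mu> * (n k - J - t k * p k) * W k \<le> y * (t k)\<^sup>2 / 2 * W k"
        using elim by (intro mult_right_mono) auto
      moreover have "(n k - J - t k * p k) * W k = (t k)\<^sup>2 * (m k - (p k)\<^sup>2)"
        unfolding W_def n_def p_def m_def by (rule j_second_order[OF vsL t(1) J])
      ultimately have "(t k)\<^sup>2 * (\<mu> * (m k - (p k)\<^sup>2)) \<le> (t k)\<^sup>2 * (y * W k / 2)"
        by (simp add: mult.assoc) (simp add: mult.left_commute)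
      then show ?case
        by (rule mult_left_le_imp_le) (use t(1)[of k] in simp)
    qed
  qed
  have bound: "\<mu> * (2 * L2_inner B q (D v) - L2_inner B q q - (dj v)\<^sup>2) \<le> y * J"
    if q: "q = (\<lambda>s. max (D v s) (- (real c * f s)))" for q c
  proof -
    \<comment> \<open>The shift by a multiple of \<open>f\<close> makes the test function
      nonnegative at the price of \<open>c * J * p k\<close>, whose limit is known.\<close>
    let ?r = "\<lambda>s. q s + real c * f s"
    have qL: "q \<in> L2 B" unfolding q using L2_strong_convD(1)[OF max_D_strong_conv[OF vL]] .
    have rL: "?r \<in> L2 B" by (intro L2_intros qL f_L2)
    have r: "AE s in B. ?r s \<ge> 0" by (auto simp: q)
    let ?g = "test_fun v ?r"
    have "\<mu> * (2 * (L2_inner Q v ?g - real c * (J * dj v)) - L2_inner B q q - (dj v)\<^sup>2)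
        \<le> y * (J + J) / 2"
    proof (rule LIMSEQ_le)
      show "(\<lambda>k. \<mu> * (2 * (L2_inner Q (vs k) ?g - real c * (J * p k)) - L2_inner B q q - (p k)\<^sup>2))
          \<longlonglongrightarrow> \<mu> * (2 * (L2_inner Q v ?g - real c * (J * dj v)) - L2_inner B q q - (dj v)\<^sup>2)"
        by (intro tendsto_intros lim test_fun_L2 vL rL p_lim)
      show "(\<lambda>k. y * W k / 2) \<longlonglongrightarrow> y * (J + J) / 2"
        by (intro tendsto_intros W_lim) auto
      have "\<forall>\<^sub>F k in sequentially.
          \<mu> * (2 * (L2_inner Q (vs k) ?g - real c * (J * p k)) - L2_inner B q q - (p k)\<^sup>2) \<le> y * W k / 2"
        using W
      proof eventually_elim
        case (elim k)
        let ?E = "E (t k) (vs k)"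
        have EL: "?E \<in> L2 B" by (intro E_L2 vsL t)
        \<comment> \<open>Duality for the square: \<open>m k\<close> is bounded below by an
          expression affine in \<open>?E\<close>, to which \<open>test_fun_le_E\<close>
          applies.\<close>
        have "0 \<le> L2_inner B (\<lambda>s. ?E s + (-1) * q s) (\<lambda>s. ?E s + (-1) * q s)"
          by (rule L2_inner_self_nonneg)
        then have "2 * L2_inner B ?E q - L2_inner B q q \<le> m k"
          unfolding L2_inner_self_add_scaled[OF EL qL] by (simp add: m_def)
        moreover have "L2_inner B ?E ?r = L2_inner B ?E q + real c * (J * p k)"
          using J by (simp add: L2_inner_add_right L2_inner_scale_right EL qL L2_scale f_L2 p_def
              L2_inner_commute[of B f])
        moreover have "L2_inner Q (vs k) ?g \<le> L2_inner B ?E ?r"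
          by (rule test_fun_le_E[OF vL vsL rL r t(1)])
        ultimately have "2 * (L2_inner Q (vs k) ?g - real c * (J * p k)) - L2_inner B q q - (p k)\<^sup>2
            \<le> m k - (p k)\<^sup>2" by argo
        then have "\<mu> * (2 * (L2_inner Q (vs k) ?g - real c * (J * p k)) - L2_inner B q q - (p k)\<^sup>2)
            \<le> \<mu> * (m k - (p k)\<^sup>2)" using \<mu> by (intro mult_left_mono) auto
        then show ?case using elim by linarith
      qed
      then show "\<exists>N. \<forall>k\<ge>N.
          \<mu> * (2 * (L2_inner Q (vs k) ?g - real c * (J * p k)) - L2_inner B q q - (p k)\<^sup>2) \<le> y * W k / 2"
        by (simp add: eventually_sequentially)
    qed
    moreover have "L2_inner Q v ?g = L2_inner B q (D v) + real c * (J * dj v)"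
      using J by (simp add: test_fun_D[OF vL rL] L2_inner_add_right L2_inner_scale_right D_L2 vL qL
          L2_scale f_L2 dj_def L2_inner_commute[of B f] L2_inner_commute[of B q])
    ultimately show ?thesis by simp
  qed
  let ?q = "\<lambda>c s. max (D v s) (- (real c * f s))"
  note conv = max_D_strong_conv[OF vL]
  \<comment> \<open>As \<open>c\<close> grows, \<open>?q c\<close> tends to \<open>D v\<close>,
    where the dual bound becomes the square of the norm of \<open>D v\<close>.\<close>
  have "\<mu> * (2 * L2_inner B (D v) (D v) - L2_inner B (D v) (D v) - (dj v)\<^sup>2) \<le> y * J"
  proof (rule LIMSEQ_le_const2)
    show "(\<lambda>c. \<mu> * (2 * L2_inner B (?q c) (D v) - L2_inner B (?q c) (?q c) - (dj v)\<^sup>2))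
        \<longlonglongrightarrow> \<mu> * (2 * L2_inner B (D v) (D v) - L2_inner B (D v) (D v) - (dj v)\<^sup>2)"
      by (intro tendsto_intros L2_strong_imp_inner[OF conv D_L2[OF vL]] L2_strong_imp_inner_self[OF conv])
  qed (use bound in blast)
  then show ?thesis using J by (simp add: curvature_def field_simps)
qed

section \<open>The extended-real functional and its weak second subderivative\<close>

definition G :: "('a \<times> 'b \<Rightarrow> real) \<Rightarrow> ereal" where
  "G u = indicator_fun U u + ereal (\<mu> * j u)"

abbreviation G'' :: "('a \<times> 'b \<Rightarrow> real) \<Rightarrow> ereal" where
  "G'' v \<equiv> weak_second_subderivative Q G u_bar (\<lambda>z. - F1 z) v"

definition Crit :: "('a \<times> 'b \<Rightarrow> real) set" where
  "Crit = {v \<in> Tan. L2_inner Q F1 v + \<mu> * dir_deriv j u_bar v = 0}"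

lemma Crit_iff: "v \<in> Crit \<longleftrightarrow> v \<in> Tan \<and> L2_inner Q F1 v + \<mu> * dj v = 0"
  by (auto simp: Crit_def dir_deriv_j Tan_L2)

lemma second_quotient_eq:
  assumes t: "t > 0"
  shows "second_quotient Q G u_bar (\<lambda>z. - F1 z) t v
    = (if (\<lambda>z. u_bar z + t * v z) \<in> U then ereal (quotient t v) else \<infinity>)"
proof -
  have "L2_inner Q (\<lambda>z. - F1 z) v = - L2_inner Q F1 v" by (simp add: L2_inner_def)
  then show ?thesis
    using t u_bar_U by (simp add: second_quotient_def G_def indicator_fun_def quotient_def J_def)
qed

text \<open>The lower limit lies below \<open>y\<close>, so the quotient does infinitely often;
  along that subsequence it is finite, which forces feasibility.\<close>

lemma less_imp_bounded_quotients:
  assumes "G'' v < ereal y"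
  obtains t vs where "\<And>k. t k > 0" "t \<longlonglongrightarrow> 0" "L2_weak_conv Q vs v"
    "\<And>k. (\<lambda>z. u_bar z + t k * vs k z) \<in> U" "\<And>k. quotient (t k) (vs k) \<le> y"
proof -
  from assms obtain t vs where t: "pos_null_seq t" and vs: "L2_weak_conv Q vs v"
    and less: "liminf (\<lambda>k. second_quotient Q G u_bar (\<lambda>z. - F1 z) (t k) (vs k)) < ereal y"
    unfolding weak_second_subderivative_def Inf_less_iff by blast
  let ?q = "\<lambda>k. second_quotient Q G u_bar (\<lambda>z. - F1 z) (t k) (vs k)"
  have "\<not> (\<forall>\<^sub>F k in sequentially. ereal y \<le> ?q k)"
    using Liminf_bounded[of "ereal y" ?q sequentially] less by auto
  from not_eventually_sequentiallyD[OF this] obtain r :: "nat \<Rightarrow> nat" where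
    r: "strict_mono r" "\<And>k. ?q (r k) < ereal y" by (auto simp: not_le)
  have pos: "t k > 0" for k using t by (simp add: pos_null_seq_def)
  have U: "(\<lambda>z. u_bar z + t (r k) * vs (r k) z) \<in> U" for k
    using r(2)[of k] by (auto simp: second_quotient_eq[OF pos] split: if_splits)
  show ?thesis
  proof (rule that[of "\<lambda>k. t (r k)" "\<lambda>k. vs (r k)"])
    show "(\<lambda>k. t (r k)) \<longlonglongrightarrow> 0"
      using LIMSEQ_subseq_LIMSEQ[OF _ r(1), of t 0] t by (simp add: pos_null_seq_def comp_def)
    show "L2_weak_conv Q (\<lambda>k. vs (r k)) v"
      using vs LIMSEQ_subseq_LIMSEQ[OF _ r(1)] unfolding L2_weak_conv_def comp_def by fast
    show "quotient (t (r k)) (vs (r k)) \<le> y" for k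
      using r(2)[of k] U[of k] by (simp add: second_quotient_eq[OF pos])
  qed (use pos U in auto)
qed

lemma not_critical_imp_infinite:
  assumes "v \<notin> Crit" shows "G'' v = \<infinity>"
proof (rule ccontr)
  assume "G'' v \<noteq> \<infinity>"
  then obtain y :: real where "G'' v < ereal y" using less_PInf_Ex_of_nat by blast
  then show False
  proof (rule less_imp_bounded_quotients)
    fix t vs
    assume *: "\<And>k. t k > 0" "t \<longlonglongrightarrow> 0" "L2_weak_conv Q vs v"
      "\<And>k. (\<lambda>z. u_bar z + t k * vs k z) \<in> U" "\<And>k. quotient (t k) (vs k) \<le> y"
    show False using bounded_quotients_critical[OF *] assms by (simp add: Crit_iff)
  qed
qed

text \<open>Each quotient is nonnegative by the subgradient inequality, or infinite off the feasible
  set.\<close>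

lemma subderivative_nonneg: "G'' v \<ge> 0"
  unfolding weak_second_subderivative_def
proof (rule Inf_greatest, clarify)
  fix t vs assume "pos_null_seq t" "L2_weak_conv Q vs v"
  then have "0 \<le> second_quotient Q G u_bar (\<lambda>z. - F1 z) (t k) (vs k)" for k
    by (auto simp: second_quotient_eq pos_null_seq_def L2_weak_conv_def quotient_nonneg)
  then show "0 \<le> liminf (\<lambda>k. second_quotient Q G u_bar (\<lambda>z. - F1 z) (t k) (vs k))"
    by (intro Liminf_bounded) simp
qed

lemma subderivative_le:
  assumes "pos_null_seq t" "L2_strong_conv Q vs v"
    and "(\<lambda>k. second_quotient Q G u_bar (\<lambda>z. - F1 z) (t k) (vs k)) \<longlonglongrightarrow> c"
  shows "G'' v \<le> c"
proof -
  have "G'' v \<le> liminf (\<lambda>k. second_quotient Q G u_bar (\<lambda>z. - F1 z) (t k) (vs k))"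
    unfolding weak_second_subderivative_def
    using assms(1) L2_strong_imp_weak[OF assms(2)] by (intro Inf_lower) blast
  then show ?thesis using lim_imp_Liminf[OF _ assms(3)] by simp
qed

lemma recovery:
  assumes v: "v \<in> Crit" and J: "J > 0" and t: "pos_null_seq t"
  shows "L2_strong_conv Q (\<lambda>k. trunc (t k) v) v"
    and "(\<lambda>k. second_quotient Q G u_bar (\<lambda>z. - F1 z) (t k) (trunc (t k) v)) \<longlonglongrightarrow> ereal (curvature v)"
proof -
  have t: "\<And>k. t k > 0" "t \<longlonglongrightarrow> 0" using t by (auto simp: pos_null_seq_def)
  have v: "v \<in> Tan" "L2_inner Q F1 v + \<mu> * dj v = 0" using v by (auto simp: Crit_iff)
  show "L2_strong_conv Q (\<lambda>k. trunc (t k) v) v" by (rule trunc_strong_conv[OF v(1) t])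
  show "(\<lambda>k. second_quotient Q G u_bar (\<lambda>z. - F1 z) (t k) (trunc (t k) v)) \<longlonglongrightarrow> ereal (curvature v)"
    using recovery_quotient[OF v J t] by (simp add: second_quotient_eq t(1) trunc_U Tan_L2 v(1))
qed

lemma pos_null_seq_inverse: "pos_null_seq (\<lambda>k. 1 / real (Suc k))"
  using null_seq_inverse by (simp add: pos_null_seq_def)

text \<open>Truncation attains the value along one null sequence. A smaller infimum would give
  quotients bounded by some \<open>y < curvature v\<close>, against
  \<open>bounded_quotients_curvature\<close>.\<close>

lemma subderivative_critical:
  assumes v: "v \<in> Crit" and J: "J > 0"
  shows "G'' v = ereal (curvature v)"
proof (rule antisym)
  show "G'' v \<le> ereal (curvature v)"
    by (rule subderivative_le[OF pos_null_seq_inverse recovery[OF v J pos_null_seq_inverse]])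
  show "ereal (curvature v) \<le> G'' v"
  proof (rule ccontr)
    assume "\<not> ereal (curvature v) \<le> G'' v"
    then have "G'' v < ereal (curvature v)" by simp
    from ereal_dense2[OF this] obtain y where y: "G'' v < ereal y" "ereal y < ereal (curvature v)"
      by blast
    from y(1) show False
    proof (rule less_imp_bounded_quotients)
      fix t vs
      assume *: "\<And>k. t k > 0" "t \<longlonglongrightarrow> 0" "L2_weak_conv Q vs v"
        "\<And>k. (\<lambda>z. u_bar z + t k * vs k z) \<in> U" "\<And>k. quotient (t k) (vs k) \<le> y"
      show False using bounded_quotients_curvature[OF * J] y(2) by simp
    qed
  qed
qed

lemma strongly_twice_epi_differentiable:
  assumes J: "J > 0"
  shows "strongly_twice_epi_differentiable Q G u_bar (\<lambda>z. - F1 z)"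
  unfolding strongly_twice_epi_differentiable_def
proof (intro ballI allI impI)
  fix v t assume v: "v \<in> L2 Q" and t: "pos_null_seq t"
  show "\<exists>vs. L2_strong_conv Q vs v \<and>
      (\<lambda>k. second_quotient Q G u_bar (\<lambda>z. - F1 z) (t k) (vs k)) \<longlonglongrightarrow> G'' v"
  proof (cases "v \<in> Crit")
    case True
    then show ?thesis using recovery[OF True J t] subderivative_critical[OF True J] by auto
  next
    case False
    note inf = not_critical_imp_infinite[OF False]
    \<comment> \<open>The infimum is infinite, so even the constant sequence \<open>v\<close> has
      quotients tending to infinity.\<close>
    let ?q = "\<lambda>k. second_quotient Q G u_bar (\<lambda>z. - F1 z) (t k) v"
    have "G'' v \<le> liminf ?q"
      unfolding weak_second_subderivative_def
      by (intro Inf_lower CollectI exI[of _ t] exI[of _ "\<lambda>k. v"])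
        (simp add: t L2_strong_imp_weak L2_strong_conv_const v)
    then have "?q \<longlonglongrightarrow> \<infinity>"
      using inf Liminf_le_Limsup[of sequentially ?q] by (intro Liminf_eq_Limsup) auto
    then show ?thesis using inf L2_strong_conv_const[OF v] by auto
  qed
qed

end

subsection \<open>The space-time cylinder\<close>

text \<open>Uniqueness of the product measure: both sides have the same measurable sets and agree on
  rectangles.\<close>

lemma restrict_lborel_pair:
  fixes X :: "'a::euclidean_space set" and Y :: "'b::euclidean_space set"
  assumes [measurable]: "X \<in> sets lborel" "Y \<in> sets lborel"
  shows "restrict_space lborel (X \<times> Y) = restrict_space lborel X \<Otimes>\<^sub>M restrict_space lborel Y"
proof (rule pair_measure_eqI[symmetric])
  have XY: "X \<times> Y \<in> sets (lborel :: ('a \<times> 'b) measure)"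
    unfolding lborel_prod[symmetric] by measurable
  have sets_iff: "A \<in> sets (restrict_space lborel X) \<longleftrightarrow> A \<subseteq> X \<and> A \<in> sets lborel"
    "B \<in> sets (restrict_space lborel Y) \<longleftrightarrow> B \<subseteq> Y \<and> B \<in> sets lborel" for A B
    using assms by (simp_all add: sets_restrict_space_iff)
  show "sigma_finite_measure (restrict_space lborel X)" "sigma_finite_measure (restrict_space lborel Y)"
    using sigma_finite_measure_restrict_space[OF sigma_finite_lborel] assms by auto
  let ?P = "restrict_space lborel X \<Otimes>\<^sub>M restrict_space lborel Y"
    and ?R = "restrict_space lborel (X \<times> Y) :: ('a \<times> 'b) measure"
  show "emeasure (restrict_space lborel X) A * emeasure (restrict_space lborel Y) B = emeasure ?R (A \<times> B)"
    if "A \<in> sets (restrict_space lborel X)" "B \<in> sets (restrict_space lborel Y)" for A B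
  proof -
    have A: "A \<in> sets lborel" "A \<subseteq> X" and B: "B \<in> sets lborel" "B \<subseteq> Y"
      using that by (auto simp: sets_iff)
    have "emeasure ?R (A \<times> B) = emeasure lborel (A \<times> B)"
      using A B XY by (intro emeasure_restrict_space) auto
    also have "\<dots> = emeasure lborel A * emeasure lborel B"
      unfolding lborel_prod[symmetric] by (rule lborel.emeasure_pair_measure_Times[OF A(1) B(1)])
    also have "emeasure lborel A = emeasure (restrict_space lborel X) A"
      using A assms by (intro emeasure_restrict_space[symmetric]) auto
    also have "emeasure lborel B = emeasure (restrict_space lborel Y) B"
      using B assms by (intro emeasure_restrict_space[symmetric]) auto
    finally show ?thesis ..
  qed
  show "sets ?P = sets ?R"
  proof
    have "A \<times> B \<in> sets ?R"
      if "A \<in> sets (restrict_space lborel X)" "B \<in> sets (restrict_space lborel Y)" for A B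
    proof -
      have A: "A \<in> sets lborel" "A \<subseteq> X" and B: "B \<in> sets lborel" "B \<subseteq> Y"
        using that by (auto simp: sets_iff)
      have "A \<times> B \<in> sets (lborel :: ('a \<times> 'b) measure)"
        unfolding lborel_prod[symmetric] using A B by (intro pair_measureI)
      then show ?thesis using A B XY by (auto simp: sets_restrict_space_iff)
    qed
    moreover have "space (restrict_space lborel X) \<times> space (restrict_space lborel Y) = space ?R"
      by (simp add: space_restrict_space)
    ultimately show "sets ?P \<subseteq> sets ?R"
      unfolding sets_pair_measure by (auto intro!: sets.sigma_sets_subset)
    show "sets ?R \<subseteq> sets ?P"
    proof
      fix Z assume "Z \<in> sets ?R"
      then have "Z \<in> sets (lborel :: ('a \<times> 'b) measure)" and ZXY: "Z \<subseteq> X \<times> Y"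
        using XY by (auto simp: sets_restrict_space_iff)
      then have Z: "Z \<in> sets (lborel \<Otimes>\<^sub>M lborel :: ('a \<times> 'b) measure)"
        unfolding lborel_prod by simp
      \<comment> \<open>The identity in coordinates, measurable into the unrestricted product; the
        preimage of \<open>Z\<close> is \<open>Z\<close>.\<close>
      have "(\<lambda>z. (fst z, snd z)) \<in> ?P \<rightarrow>\<^sub>M lborel \<Otimes>\<^sub>M lborel"
        by (intro measurable_Pair measurable_compose[OF measurable_fst]
            measurable_compose[OF measurable_snd] measurable_restrict_space1) auto
      from measurable_sets[OF this Z] show "Z \<in> sets ?P"
        using ZXY by (simp add: space_pair_measure space_restrict_space Int_absorb2)
    qed
  qed
qed

text \<open>The slices of an \<open>L\<^sup>2\<close> function may fail to be integrable on a null set of times, where \<open>dir_deriv\<close> is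
  junk. The time integral in the theorem is meaningful only because the junk is still measurable: if \<open>u\<close>
  and \<open>v\<close> are not both integrable, then \<open>u + s v\<close> is integrable for at most one \<open>s\<close>.\<close>

lemma dir_deriv_L1_norm:
  assumes [measurable]: "u \<in> borel_measurable M" "v \<in> borel_measurable M"
  shows "dir_deriv (L1_norm M) u v =
    (if integrable M u \<and> integrable M v then \<integral>x. abs_deriv (u x) (v x) \<partial>M
     else if L1_norm M u = 0 then 0 else (THE l. False))"
proof (cases "integrable M u \<and> integrable M v")
  case True
  then show ?thesis
    using L1_norm_directionally_differentiable[of M u v]
    by (simp add: dir_deriv_def abs_deriv_def tendsto_Lim)
next
  case False
  have "\<exists>\<delta>>0. \<forall>s. 0 < s \<and> s < \<delta> \<longrightarrow> \<not> integrable M (\<lambda>x. u x + s * v x)"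
  proof (rule ccontr)
    assume *: "\<not> ?thesis"
    then obtain a where a: "0 < a" "integrable M (\<lambda>x. u x + a * v x)"
      by (meson zero_less_one)
    with * obtain b where b: "0 < b" "b < a" "integrable M (\<lambda>x. u x + b * v x)" by blast
    have "integrable M (\<lambda>x. ((u x + a * v x) - (u x + b * v x)) / (a - b))"
      by (intro integrable_divide Bochner_Integration.integrable_diff a b)
    moreover have "((u x + a * v x) - (u x + b * v x)) / (a - b) = v x" for x
      using b by (simp add: left_diff_distrib[symmetric])
    ultimately have v: "integrable M v" by simp
    have "integrable M (\<lambda>x. (u x + a * v x) - a * v x)"
      by (intro Bochner_Integration.integrable_diff a integrable_mult_right v)
    then show False using False v by simp
  qed
  then obtain \<delta> where \<delta>: "\<delta> > 0" "\<And>s. 0 < s \<Longrightarrow> s < \<delta> \<Longrightarrow> \<not> integrable M (\<lambda>x. u x + s * v x)"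
    by blast
  \<comment> \<open>For these \<open>s\<close> the perturbed norm is the default value 0.\<close>
  have ev: "\<forall>\<^sub>F s in at_right 0. (L1_norm M (\<lambda>x. u x + s * v x) - L1_norm M u) / s = - L1_norm M u / s"
    using eventually_at_right_less eventually_at_right_real[OF \<delta>(1)]
  proof eventually_elim
    case (elim s)
    have "\<not> integrable M (\<lambda>x. \<bar>u x + s * v x\<bar>)"
      using \<delta>(2)[of s] elim integrable_abs_iff[of "\<lambda>x. u x + s * v x" M] by auto
    then show ?case by (simp add: L1_norm_def not_integrable_integral_eq)
  qed
  show ?thesis
  proof (cases "L1_norm M u = 0")
    case True
    have "((\<lambda>s. (L1_norm M (\<lambda>x. u x + s * v x) - L1_norm M u) / s) \<longlongrightarrow> 0) (at_right 0)"
      by (rule tendsto_eventually) (use ev True in \<open>auto elim!: eventually_mono\<close>)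
    then show ?thesis using False True by (auto simp: dir_deriv_def tendsto_Lim)
  next
    case n: False
    have "\<not> ((\<lambda>s. (L1_norm M (\<lambda>x. u x + s * v x) - L1_norm M u) / s) \<longlongrightarrow> l) (at_right 0)" for l
    proof
      assume "((\<lambda>s. (L1_norm M (\<lambda>x. u x + s * v x) - L1_norm M u) / s) \<longlongrightarrow> l) (at_right 0)"
      \<comment> \<open>Multiplying by \<open>s\<close> would force the nonzero constant
        \<open>- L1_norm M u\<close> to tend to 0, so no limit exists and \<open>Lim\<close> is
        \<open>THE l. False\<close>.\<close>
      then have "((\<lambda>s. (L1_norm M (\<lambda>x. u x + s * v x) - L1_norm M u) / s * s) \<longlongrightarrow> l * 0) (at_right 0)"
        by (intro tendsto_intros)
      moreover have "\<forall>\<^sub>F s in at_right 0.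
          (L1_norm M (\<lambda>x. u x + s * v x) - L1_norm M u) / s * s = - L1_norm M u"
        using ev eventually_at_right_less by eventually_elim simp
      ultimately have "((\<lambda>s::real. - L1_norm M u) \<longlongrightarrow> l * 0) (at_right 0)"
        by (rule Lim_transform_eventually)
      then show False using n by (simp add: tendsto_const_iff)
    qed
    then show ?thesis using False n by (auto simp: dir_deriv_def t2_space_class.Lim_def)
  qed
qed

text \<open>For almost every \<open>t\<close> both slices are integrable and the derivative is
  \<open>D v t\<close>; the case formula \<open>?e\<close> holds at every \<open>t\<close> and shows
  that the integrand is measurable.\<close>

lemma (in sparse_box_problem) integral_dir_deriv_square:
  assumes v: "v \<in> L2 Q"
  shows "(\<integral>t. (dir_deriv (L1_norm A) (\<lambda>x. u_bar (x, t)) (\<lambda>x. v (x, t)))\<^sup>2 \<partial>B)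
    = L2_inner B (D v) (D v)"
proof -
  have [measurable]: "v \<in> borel_measurable Q" "D v \<in> borel_measurable B" using v D_L2 by auto
  have u': "(\<lambda>(t, x). u_bar (x, t)) \<in> borel_measurable (B \<Otimes>\<^sub>M A)"
    and v': "(\<lambda>(t, x). v (x, t)) \<in> borel_measurable (B \<Otimes>\<^sub>M A)"
    by (auto intro: measurable_pair_swap)
  note [measurable] = A.borel_measurable_lebesgue_integrable[OF u'] A.borel_measurable_lebesgue_integrable[OF v']
  have [measurable]: "(\<lambda>t. L1_norm A (\<lambda>x. u_bar (x, t))) \<in> borel_measurable B"
    using f_L2 by (simp add: f_def slice_integral_def L1_norm_def L2_def)
  let ?d = "\<lambda>t. dir_deriv (L1_norm A) (\<lambda>x. u_bar (x, t)) (\<lambda>x. v (x, t))"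
  let ?e = "\<lambda>t. if integrable A (\<lambda>x. u_bar (x, t)) \<and> integrable A (\<lambda>x. v (x, t)) then D v t
     else if L1_norm A (\<lambda>x. u_bar (x, t)) = 0 then 0 else (THE l. False)"
  have "?d t = ?e t" if "t \<in> space B" for t
    using that by (subst dir_deriv_L1_norm) (auto simp: D_def slice_integral_def)
  then have "(\<integral>t. (?d t)\<^sup>2 \<partial>B) = (\<integral>t. (?e t)\<^sup>2 \<partial>B)"
    by (intro Bochner_Integration.integral_cong) auto
  also have "\<dots> = (\<integral>t. D v t * D v t \<partial>B)"
  proof (rule integral_cong_AE)
    show "AE t in B. (?e t)\<^sup>2 = D v t * D v t"
      using slice_integrable[OF u_bar] slice_integrable[OF v]
      by eventually_elim (simp add: power2_eq_square)
  qed measurable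
  finally show ?thesis by (simp add: L2_inner_def)
qed

theorem theorem3p13:
  fixes \<Omega> :: "(real ^ 'd) set"
    and T \<alpha> \<beta> \<mu> :: real
    and u_bar F1 :: "(real ^ 'd) \<times> real \<Rightarrow> real"
    and F :: "((real ^ 'd) \<times> real \<Rightarrow> real) \<Rightarrow> real"
    and F2 :: "((real ^ 'd) \<times> real \<Rightarrow> real) \<Rightarrow> ((real ^ 'd) \<times> real \<Rightarrow> real) \<Rightarrow> real"
  defines "M \<equiv> cyl_measure \<Omega> T"
    and "G2 \<equiv> G_2 \<Omega> T \<alpha> \<beta> \<mu>"
    and "C \<equiv> critical_cone \<Omega> T \<alpha> \<beta> \<mu> F1 u_bar"
  assumes "\<Omega> \<noteq> {}" and "open \<Omega>" and "bounded \<Omega>"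
    and "T > 0" and "\<alpha> < \<beta>" and "\<mu> > 0"
    and "u_bar \<in> U_ad \<Omega> T \<alpha> \<beta>"
    and F_well_defined:
      "\<And>u v. u \<in> U_ad \<Omega> T \<alpha> \<beta> \<Longrightarrow> v \<in> U_ad \<Omega> T \<alpha> \<beta> \<Longrightarrow> (AE z in M. u z = v z) \<Longrightarrow> F u = F v"
    and "F1 \<in> L2 M"
    and "L2_bounded_bilinear M F2"
    and F_expansion:
      "\<And>t vs v. pos_null_seq t \<Longrightarrow> L2_weak_conv M vs v \<Longrightarrow>
         (\<And>k. (\<lambda>z. u_bar z + t k * vs k z) \<in> U_ad \<Omega> T \<alpha> \<beta>) \<Longrightarrow>
         (\<lambda>k. (F (\<lambda>z. u_bar z + t k * vs k z) - F u_bar - t k * L2_inner M F1 (vs k)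
                 - 1 / 2 * (t k)\<^sup>2 * F2 (vs k) (vs k)) / (t k)\<^sup>2) \<longlonglongrightarrow> 0"
    and "(\<lambda>z. - F1 z) \<in> subdifferential M G2 u_bar"
  shows
    "(\<not> (AE z in M. u_bar z = 0) \<longrightarrow>
        (\<forall>v\<in>C. weak_second_subderivative M G2 u_bar (\<lambda>z. - F1 z) v =
           ereal (\<mu> / j_2 \<Omega> T u_bar *
             ((\<integral>t. (dir_deriv (j_Omega \<Omega>) (\<lambda>x. u_bar (x, t)) (\<lambda>x. v (x, t)))\<^sup>2 \<partial>time_measure T)
                - (dir_deriv (j_2 \<Omega> T) u_bar v)\<^sup>2))) \<and>
        strongly_twice_epi_differentiable M G2 u_bar (\<lambda>z. - F1 z)) \<and>
     ((AE z in M. u_bar z = 0) \<longrightarrow>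
        (\<forall>v\<in>C. weak_second_subderivative M G2 u_bar (\<lambda>z. - F1 z) v \<ge> 0) \<and>
        (\<forall>v\<in>L2 M - C. weak_second_subderivative M G2 u_bar (\<lambda>z. - F1 z) v = \<infinity>))"
proof -
  let ?A = "space_measure \<Omega>" and ?B = "time_measure T"
  have \<Omega>: "\<Omega> \<in> sets lborel" using \<open>open \<Omega>\<close> by simp
  have M: "M = ?A \<Otimes>\<^sub>M ?B"
    unfolding M_def using \<Omega> by (intro restrict_lborel_pair) auto
  have fin: "finite_measure (restrict_space lborel X)" if "bounded X" "X \<in> sets lborel"
    for X :: "'x::euclidean_space set"
  proof (rule finite_measureI)
    have "emeasure lborel X < \<infinity>" using that(1) by (rule emeasure_bounded_finite)
    then show "emeasure (restrict_space lborel X) (space (restrict_space lborel X)) \<noteq> \<infinity>"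
      using that(2) by (simp add: emeasure_restrict_space space_restrict_space)
  qed
  interpret A: finite_measure ?A using fin \<open>bounded \<Omega>\<close> \<Omega> by blast
  interpret B: finite_measure ?B using fin[of "{0<..<T}"] by (simp add: bounded_box)
  interpret finite_product ?A ?B ..
  have j_2: "j_2 \<Omega> T = (\<lambda>u. L2_norm ?B (slice_integral ?A (\<lambda>z. \<bar>u z\<bar>)))"
    by (simp add: j_2_def L2_norm_def slice_integral_def L1_norm_def fun_eq_iff)
  have U_ad: "U_ad \<Omega> T \<alpha> \<beta> = {u \<in> L2 Q. AE z in Q. \<alpha> \<le> u z \<and> u z \<le> \<beta>}"
    unfolding U_ad_def M[unfolded M_def] ..
  have u_bar: "u_bar \<in> L2 Q" "AE z in Q. \<alpha> \<le> u_bar z \<and> u_bar z \<le> \<beta>"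
    using \<open>u_bar \<in> U_ad \<Omega> T \<alpha> \<beta>\<close> by (auto simp: U_ad)
  \<comment> \<open>For \<open>z\<close> in the box both indicator terms vanish, so the
    extended-real subgradient inequality becomes a real one.\<close>
  interpret sparse_box_problem ?A ?B \<alpha> \<beta> \<mu> u_bar F1
  proof
    fix z assume z: "z \<in> L2 Q" "AE x in Q. \<alpha> \<le> z x \<and> z x \<le> \<beta>"
    then have "z \<in> U_ad \<Omega> T \<alpha> \<beta>" by (simp add: U_ad)
    moreover have "G2 z \<ge> G2 u_bar + ereal (L2_inner M (\<lambda>z. - F1 z) (\<lambda>x. z x - u_bar x))"
      using \<open>(\<lambda>z. - F1 z) \<in> subdifferential M G2 u_bar\<close> z(1) by (simp add: subdifferential_def M)
    moreover have "L2_inner M (\<lambda>z. - F1 z) h = - L2_inner Q F1 h" for h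
      by (simp add: L2_inner_def M)
    ultimately show "\<mu> * L2_norm ?B (slice_integral ?A (\<lambda>z. \<bar>u_bar z\<bar>))
        \<le> \<mu> * L2_norm ?B (slice_integral ?A (\<lambda>x. \<bar>z x\<bar>)) + L2_inner Q F1 (\<lambda>x. z x - u_bar x)"
      using \<open>u_bar \<in> U_ad \<Omega> T \<alpha> \<beta>\<close> by (simp add: G2_def G_2_def indicator_fun_def j_2)
  qed (use \<open>\<mu> > 0\<close> \<open>F1 \<in> L2 M\<close> u_bar in \<open>simp_all add: M\<close>)
  have j: "j_2 \<Omega> T = j" by (simp add: j_2 j_def fun_eq_iff)
  have U: "U_ad \<Omega> T \<alpha> \<beta> = U" by (simp add: U_ad U_def)
  have G: "G2 = G" by (simp add: G2_def G_2_def G_def U j fun_eq_iff)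
  have C: "C = Crit"
    unfolding C_def critical_cone_def tangent_cone_def Crit_def Tan_def M[unfolded M_def] j ..
  have jO: "j_Omega \<Omega> = L1_norm ?A" by (simp add: j_Omega_def fun_eq_iff)
  have curv: "ereal (\<mu> / j_2 \<Omega> T u_bar *
      ((\<integral>t. (dir_deriv (j_Omega \<Omega>) (\<lambda>x. u_bar (x, t)) (\<lambda>x. v (x, t)))\<^sup>2 \<partial>?B)
        - (dir_deriv (j_2 \<Omega> T) u_bar v)\<^sup>2)) = ereal (curvature v)" if "v \<in> Crit" for v
  proof -
    have v: "v \<in> L2 Q" using that by (simp add: Crit_iff Tan_L2)
    show ?thesis
      by (simp add: curvature_def J_def j jO dir_deriv_j[OF v] integral_dir_deriv_square[OF v])
  qed
  have J: "J > 0" if "\<not> (AE z in Q. u_bar z = 0)"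
    using that J_zero_imp J_nonneg by (metis less_eq_real_def)
  \<comment> \<open>The formula and the recovery sequence rely on \<open>J > 0\<close>;
    nonnegativity and the infinite value come from lemmas valid for every \<open>J\<close>.\<close>
  show ?thesis
    unfolding G C M
    using curv subderivative_critical J strongly_twice_epi_differentiable subderivative_nonneg
      not_critical_imp_infinite by auto
qed

end
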